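(* Let $(b_n)_{n\in\mathbb{N}}$ be a sequence of positive integers. If $$\sum_{n\in\mathbb{N}}\frac1{b_n}=\infty,$$ then for $S_n:=\sum_{k=1}^n\mathbf{1}_{\{a_k>b_k\}}$ we have, for every $z\in\mathbb{R}$, $$\lim_{n\to\infty}\mathfrak{m}\left(\frac{S_n-\mathbb{E}(S_n)}{\sqrt{\mathbb{V}(S_n)}}<z\right)=\frac{1}{\sqrt{2\pi}}\int_{-\infty}^z e^{-t^2/2}\,\mathrm{d}t.$$
   Context: $I=[0,1)$ with its Borel $\sigma$-algebra. The Gauss map $G:I\to I$ is $G(\omega)=1/\omega-\lfloor 1/\omega\rfloor$ for $\omega\neq0$ and $G(0)=0$. The continued fraction digits are $a_n(\omega)=\lfloor 1/G^{n-1}(\omega)\rfloor$, $n\in\mathbb{N}=\{1,2,\dots\}$, defined for all irrational $\omega\in I$ (hence almost everywhere), so that $\omega=[a_1(\omega),a_2(\omega),\dots]$ is the regular continued fraction expansion of $\omega$. $\mathfrak{m}$ denotes the Gauss measure on $I$, i.e. the $G$-invariant probability measure with Lebesgue density $h(x)=1/((x+1)\log 2)$. $\mathbf{1}_A$ is the indicator function of $A$. $\mathbb{E}(X)$ and $\mathbb{V}(X)=\mathbb{E}((X-\mathbb{E}(X))^2)$ denote expectation and variance with respect to $\mathfrak{m}$. *)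

theory Defs
  imports "HOL-Probability.Probability"
begin

definition gauss_map :: "real \<Rightarrow> real" where
  "gauss_map \<omega> = (if \<omega> = 0 then 0 else 1 / \<omega> - of_int \<lfloor>1 / \<omega>\<rfloor>)"

text \<open>
  Meaningful for \<open>n \<ge> 1\<close> and irrational \<open>\<omega>\<close>. At rational \<open>\<omega>\<close> the expansion terminates
  and, because \<open>1 / 0 = 0\<close>, all digits from then on are \<open>0\<close>; this concerns only a null set.
\<close>
definition cf_digit :: "nat \<Rightarrow> real \<Rightarrow> int" where
  "cf_digit n \<omega> = \<lfloor>1 / (gauss_map ^^ (n - 1)) \<omega>\<rfloor>"

definition gauss_measure :: "real measure" where
  "gauss_measure =
     density (restrict_space lborel {0..<1}) (\<lambda>x. ennreal (1 / ((x + 1) * ln 2)))"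

lemma prob_space_gauss_measure: "prob_space gauss_measure"
proof
  let ?h = "\<lambda>x::real. 1 / ((x + 1) * ln 2)"
  have "emeasure gauss_measure (space gauss_measure) =
          (\<integral>\<^sup>+ x. ennreal (?h x) \<partial>restrict_space lborel {0..<1})"
  proof -
    have m: "(\<lambda>x. ennreal (?h x)) \<in> borel_measurable (restrict_space lborel {0..<1})"
      by (rule measurable_restrict_space1) simp
    have "{0..<1} \<in> sets (restrict_space lborel {0..<1::real})"
      by (auto simp: sets_restrict_space_iff)
    then show ?thesis
      unfolding gauss_measure_def
      by (auto simp: emeasure_density[OF m] space_restrict_space intro!: nn_integral_cong)
  qed
  also have "\<dots> = (\<integral>\<^sup>+ x. ennreal (?h x) * indicator {0..<1} x \<partial>lborel)"
    by (subst nn_integral_restrict_space) auto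
  also have "\<dots> = (\<integral>\<^sup>+ x. ennreal (?h x) * indicator {0..1} x \<partial>lborel)"
    by (intro nn_integral_cong_AE AE_I[where N = "{1}"]) (auto simp: indicator_def)
  also have "\<dots> = ennreal (ln (1 + 1) / ln 2 - ln (0 + 1) / ln 2)"
    by (rule nn_integral_FTC_Icc[where F = "\<lambda>x. ln (x + 1) / ln 2"])
       (auto intro!: derivative_eq_intros simp: has_real_derivative_iff_has_vector_derivative[symmetric])
  also have "\<dots> = 1" by simp
  finally show "emeasure gauss_measure (space gauss_measure) = 1" .
qed

interpretation gauss: prob_space gauss_measure
  by (rule prob_space_gauss_measure)

definition exceedance_count :: "(nat \<Rightarrow> nat) \<Rightarrow> nat \<Rightarrow> real \<Rightarrow> real" where
  "exceedance_count b n \<omega> = (\<Sum>k = 1..n. indicator {x. cf_digit k x > int (b k)} \<omega>)"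

end

theory Submission
  imports Defs "HOL-Real_Asymp.Real_Asymp"
begin

text \<open>
  The \<open>k\<close>-th exceedance is the indicator of \<^term>\<open>{0<..1 / (b k + 1)}\<close> at the image of the point
  under \<open>k - 1\<close> steps of the Gauss map, so that the count is a sum along orbits of a
  measure-preserving map. It is studied through the transfer operator \<open>P\<close> of the Gauss map with
  respect to the Gauss measure, the conditional expectation given the image point. This operator
  preserves the integral and contracts Lipschitz seminorms on the unit interval by the factor
  \<open>5/6\<close> (\<open>lipschitz_gauss_transfer\<close>); it also turns the discontinuous indicator of the exceedance
  set \<open>A k\<close>, and its product with a Lipschitz function, into a Lipschitz function
  (\<open>lipschitz_gauss_tail_transfer\<close>).

  Let \<open>p k\<close> be the probability of the \<open>k\<close>-th exceedance, which is of the order of \<open>1 / b k\<close>, and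
  let \<open>\<eta> k\<close> be the conditional expectation of the centred count given the \<open>k\<close>-th image point:
  \<open>\<eta> 0 = 0\<close> and \<open>\<eta> k = P (\<eta> (k - 1) + indicator (A k) - p k)\<close>. By the contraction, the
  functions \<open>\<eta> k\<close> are uniformly bounded and have Lipschitz constant \<open>3/2\<close>. Subtracting from
  \<open>\<eta> (k - 1) + indicator (A k) - p k\<close> the composition of \<open>\<eta> k\<close> with the Gauss map gives
  reverse martingale differences, whose second moments add up to the variance of the count up to a
  bounded term. Each of them is at least a constant times \<open>1 / b k\<close>, because \<open>\<eta> (k - 1)\<close> varies
  too slowly to cancel the jump of the indicator (\<open>martingale_difference_lower_bound\<close>). Hence the
  variance is at least a constant times the mean and tends to infinity with the sum of the
  \<open>1 / b k\<close> (\<open>variance_lower_bound\<close>).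

  The characteristic function of the count at \<open>t\<close> is the integral of the function \<open>g n\<close> given by
  \<open>g 0 = 1\<close> and \<open>g k = P (g (k - 1) * (1 + \<zeta> * indicator (A k)))\<close>, where \<open>\<zeta> = cis t - 1\<close>. With
  \<open>c k\<close> the integral of \<open>g k\<close>, the function \<open>g k\<close> equals \<open>c k * (1 + \<zeta> * \<eta> k)\<close> up to an error of
  order \<open>t\<^sup>2\<close>, uniformly in \<open>k\<close> (\<open>lipschitz_char_rem\<close>). Therefore \<open>c k\<close> arises from \<open>c (k - 1)\<close>
  by multiplication with a factor that is known up to an error of order \<open>\<bar>t\<bar> ^ 3 * p k\<close>, and which,
  after centring, is the exponential of \<open>- t\<^sup>2 / 2\<close> times the \<open>k\<close>-th increment of the variance
  (\<open>char_count_asymp\<close>). Taking for \<open>t\<close> a constant divided by the standard deviation, the errors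
  sum up to a quantity that tends to \<open>0\<close>, and Levy's continuity theorem concludes.
\<close>

section \<open>The transfer operator of the Gauss map\<close>

text \<open>The inverse branches of the Gauss map. Branches are numbered from \<open>0\<close>: the branch \<open>k\<close>
  carries the digit \<open>k + 1\<close>.\<close>

definition gauss_branch :: "nat \<Rightarrow> real \<Rightarrow> real" where
  "gauss_branch k x = 1 / (real k + 1 + x)"

text \<open>The conditional probability, under the Gauss measure, that a point with image \<open>x\<close> under
  the Gauss map lies on the branch \<open>k\<close>.\<close>

definition gauss_weight :: "nat \<Rightarrow> real \<Rightarrow> real" where
  "gauss_weight k x = (1 + x) / ((real k + 1 + x) * (real k + 2 + x))"

text \<open>The transfer operator with respect to the Gauss measure, that is, the conditional
  expectation of \<open>f\<close> given the image point. The functions of interest are bounded on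
  \<open>{0..1}\<close>, where the series then converges.\<close>

definition gauss_transfer :: "(real \<Rightarrow> 'a::banach) \<Rightarrow> real \<Rightarrow> 'a" where
  "gauss_transfer f x = (\<Sum>k. gauss_weight k x *\<^sub>R f (gauss_branch k x))"

lemma gauss_branch_mem: "x \<in> {0..1} \<Longrightarrow> gauss_branch k x \<in> {0..1}"
  by (auto simp: gauss_branch_def field_simps)

lemma gauss_weight_nonneg: "x \<in> {0..1} \<Longrightarrow> 0 \<le> gauss_weight k x"
  by (auto simp: gauss_weight_def)

lemma gauss_map_branch: "x \<in> {0..<1} \<Longrightarrow> gauss_map (gauss_branch k x) = x"
proof -
  assume x: "x \<in> {0..<1}"
  have "\<lfloor>real k + 1 + x\<rfloor> = int k + 1"
    using x by (intro floor_unique) auto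
  then show ?thesis
    using x by (auto simp: gauss_map_def gauss_branch_def)
qed

lemma sum_gauss_weight:
  assumes "x \<in> {0..1}"
  shows "(\<Sum>k<n. gauss_weight k x) = real n / (real n + 1 + x)"
proof (induction n)
  case (Suc n)
  have "real n + 1 + x \<noteq> 0" "real n + 2 + x \<noteq> 0" "real (Suc n) + 1 + x = real n + 2 + x"
    using assms by auto
  moreover have "(\<Sum>k<Suc n. gauss_weight k x) = real n / (real n + 1 + x) + gauss_weight n x"
    using Suc by simp
  ultimately show ?case
    by (simp only: gauss_weight_def) (simp add: divide_simps, simp add: algebra_simps)
qed simp

lemma sums_gauss_weight:
  assumes "x \<in> {0..1}"
  shows "(\<lambda>k. gauss_weight k x) sums 1"
proof -
  have "(\<lambda>n. real n / (real n + 1 + x)) \<longlonglongrightarrow> 1"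
    by real_asymp
  then show ?thesis
    unfolding sums_def by (simp add: sum_gauss_weight[OF assms])
qed

lemma sums_gauss_weight_tail:
  assumes "x \<in> {0..1}"
  shows "(\<lambda>k. if b \<le> k then gauss_weight k x else 0) sums ((1 + x) / (real b + 1 + x))"
proof -
  have "(\<lambda>k. if k \<in> {..<b} then gauss_weight k x else 0) sums (\<Sum>k<b. gauss_weight k x)"
    by (rule sums_If_finite_set) simp
  from sums_diff[OF sums_gauss_weight[OF assms] this]
  have "(\<lambda>k. if b \<le> k then gauss_weight k x else 0) sums (1 - (\<Sum>k<b. gauss_weight k x))"
    by (rule sums_cong[THEN iffD1, rotated]) auto
  moreover have "1 - (\<Sum>k<b. gauss_weight k x) = (1 + x) / (real b + 1 + x)"
    using assms by (simp add: sum_gauss_weight field_simps)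
  ultimately show ?thesis by simp
qed

lemma summable_gauss_transfer:
  fixes f :: "real \<Rightarrow> 'a::banach"
  assumes "\<And>y. y \<in> {0..1} \<Longrightarrow> norm (f y) \<le> B" and "x \<in> {0..1}"
  shows "summable (\<lambda>k. gauss_weight k x *\<^sub>R f (gauss_branch k x))"
proof (rule summable_comparison_test')
  show "summable (\<lambda>k. gauss_weight k x * B)"
    using sums_gauss_weight[OF assms(2)] by (intro summable_mult2) (rule sums_summable)
  show "norm (gauss_weight k x *\<^sub>R f (gauss_branch k x)) \<le> gauss_weight k x * B" if "0 \<le> k" for k
    using assms gauss_branch_mem[OF assms(2)] gauss_weight_nonneg[OF assms(2)]
    by (auto intro!: mult_left_mono)
qed

lemma norm_gauss_transfer_le:
  fixes f :: "real \<Rightarrow> 'a::banach"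
  assumes "\<And>y. y \<in> {0..1} \<Longrightarrow> norm (f y) \<le> B" and "x \<in> {0..1}"
  shows "norm (gauss_transfer f x) \<le> B"
proof -
  have s: "summable (\<lambda>k. gauss_weight k x * B)"
    using sums_gauss_weight[OF assms(2)] by (intro summable_mult2) (rule sums_summable)
  have "norm (gauss_transfer f x) \<le> (\<Sum>k. gauss_weight k x * B)"
    unfolding gauss_transfer_def
    using assms gauss_branch_mem[OF assms(2)] gauss_weight_nonneg[OF assms(2)]
    by (intro norm_suminf_le s) (auto intro!: mult_left_mono)
  also have "\<dots> = B"
    using sums_mult2[OF sums_gauss_weight[OF assms(2)], of B] by (simp add: sums_iff)
  finally show ?thesis .
qed

lemma gauss_transfer_add:
  fixes f g :: "real \<Rightarrow> 'a::banach"
  assumes "\<And>y. y \<in> {0..1} \<Longrightarrow> norm (f y) \<le> B" "\<And>y. y \<in> {0..1} \<Longrightarrow> norm (g y) \<le> C"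
    and "x \<in> {0..1}"
  shows "gauss_transfer (\<lambda>y. f y + g y) x = gauss_transfer f x + gauss_transfer g x"
  unfolding gauss_transfer_def
  by (subst suminf_add[OF summable_gauss_transfer[OF assms(1,3)] summable_gauss_transfer[OF assms(2,3)]])
    (auto simp: scaleR_add_right)

lemma gauss_transfer_const [simp]: "x \<in> {0..1} \<Longrightarrow> gauss_transfer (\<lambda>_. c) x = c"
  using sums_scaleR_left[OF sums_gauss_weight, of x c] by (simp add: gauss_transfer_def sums_iff)

lemma gauss_transfer_linear:
  fixes f :: "real \<Rightarrow> 'a::banach"
  assumes "bounded_linear T" "\<And>y. y \<in> {0..1} \<Longrightarrow> norm (f y) \<le> B" "x \<in> {0..1}"
  shows "gauss_transfer (\<lambda>y. T (f y)) x = T (gauss_transfer f x)"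
proof -
  interpret T: bounded_linear T by fact
  show ?thesis
    unfolding gauss_transfer_def
    by (subst T.suminf[OF summable_gauss_transfer[OF assms(2,3)]]) (auto simp: T.scaleR)
qed

text \<open>A factor that depends on the image point only can be pulled out.\<close>

lemma gauss_transfer_pull_out:
  fixes f :: "real \<Rightarrow> 'a::{banach,real_normed_algebra}"
  assumes "\<And>y. y \<in> {0..1} \<Longrightarrow> norm (f y) \<le> B" and "x \<in> {0..<1}"
  shows "gauss_transfer (\<lambda>y. f y * h (gauss_map y)) x = gauss_transfer f x * h x"
proof -
  have "gauss_transfer (\<lambda>y. f y * h (gauss_map y)) x = gauss_transfer (\<lambda>y. f y * h x) x"
    by (simp add: gauss_transfer_def gauss_map_branch[OF assms(2)])
  also have "\<dots> = gauss_transfer f x * h x"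
    using gauss_transfer_linear[OF bounded_linear_mult_left[of "h x"] assms(1)] assms(2) by simp
  finally show ?thesis .
qed

lemma borel_measurable_gauss_branch [measurable]: "gauss_branch k \<in> borel_measurable borel"
  unfolding gauss_branch_def by measurable

lemma borel_measurable_gauss_weight [measurable]: "gauss_weight k \<in> borel_measurable borel"
  unfolding gauss_weight_def by measurable

lemma borel_measurable_gauss_transfer [measurable]:
  fixes f :: "real \<Rightarrow> 'a::{banach,second_countable_topology}"
  assumes [measurable]: "f \<in> borel_measurable borel"
  shows "gauss_transfer f \<in> borel_measurable borel"
  unfolding gauss_transfer_def by measurable

lemma borel_measurable_gauss_map [measurable]: "gauss_map \<in> borel_measurable borel"
  unfolding gauss_map_def by measurable

section \<open>Contraction on Lipschitz functions\<close>

lemma sum_inverse_cubes_le: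
  "(\<Sum>k<n. 1 / (real k + 2) ^ 3) \<le> 5 / 24"
proof (cases n)
  case (Suc m)
  \<comment> \<open>Each cube is compared with a telescoping product of three consecutive numbers; only
      the first term is kept exact, which is what brings the bound down to 5/24.\<close>
  have "(\<Sum>k<Suc m. 1 / (real k + 2) ^ 3) \<le> 5 / 24 - 1 / (2 * ((real m + 2) * (real m + 3)))"
  proof (induction m)
    case (Suc m)
    have "1 / (real m + 3) ^ 3 \<le> 1 / ((real m + 2) * (real m + 3) * (real m + 4))"
    proof (intro divide_left_mono)
      have "(real m + 3) * ((real m + 2) * (real m + 4)) \<le> (real m + 3) * (real m + 3)\<^sup>2"
        by (intro mult_left_mono) (auto simp: power2_eq_square algebra_simps)
      then show "(real m + 2) * (real m + 3) * (real m + 4) \<le> (real m + 3) ^ 3"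
        by (simp add: power2_eq_square power3_eq_cube mult_ac)
    qed auto
    also have "\<dots> = 1 / (2 * ((real m + 2) * (real m + 3))) - 1 / (2 * ((real m + 3) * (real m + 4)))"
      by (simp add: divide_simps)
    finally show ?case using Suc by (simp add: add_ac)
  qed simp
  also have "\<dots> \<le> 5 / 24" by simp
  finally show ?thesis using Suc by simp
qed simp

lemma sum_by_parts_lessThan:
  fixes f :: "nat \<Rightarrow> 'a::real_vector" and D :: "nat \<Rightarrow> real"
  assumes "D 0 = 0"
  shows "(\<Sum>k<n. (D (Suc k) - D k) *\<^sub>R f k) = D n *\<^sub>R f n - (\<Sum>k<n. D (Suc k) *\<^sub>R (f (Suc k) - f k))"
  using assms by (induction n) (auto simp: algebra_simps)

text \<open>The two sources of variation of the transferred function, the motion of the branch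
  points and the change of the weights, contribute at most \<open>5/8\<close> and \<open>5/24\<close> to the contraction
  factor. The change of the weights is summed by parts, with a boundary term that vanishes in the
  limit.\<close>

lemma gauss_transfer_branch_part:
  assumes x: "x \<in> {0..1}" and y: "y \<in> {0..1}"
  shows "(\<Sum>k<n. gauss_weight k x * \<bar>gauss_branch k x - gauss_branch k y\<bar>) \<le> 5 / 8 * \<bar>x - y\<bar>"
proof -
  define c where "c = (1 / (1 + x) - 1 / 4) * gauss_weight 0 x"
  have diff: "\<bar>gauss_branch k x - gauss_branch k y\<bar> = \<bar>x - y\<bar> / ((real k + 1 + x) * (real k + 1 + y))" for k
  proof -
    have "gauss_branch k x - gauss_branch k y = (y - x) / ((real k + 1 + x) * (real k + 1 + y))"
      using x y by (auto simp: gauss_branch_def divide_simps)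
    moreover have "(real k + 1 + x) * (real k + 1 + y) > 0" using x y by auto
    ultimately show ?thesis by (simp add: abs_divide abs_minus_commute)
  qed
  have term_le: "gauss_weight k x * \<bar>gauss_branch k x - gauss_branch k y\<bar>
      \<le> (gauss_weight k x / 4 + (if k = 0 then c else 0)) * \<bar>x - y\<bar>" for k
  proof (cases "k = 0")
    case True
    have "1 + x \<le> (1 + x) * (1 + y)"
      using x y by (simp add: algebra_simps)
    then have "gauss_weight 0 x * (1 / ((1 + x) * (1 + y))) \<le> gauss_weight 0 x * (1 / (1 + x))"
      using x y by (intro mult_left_mono gauss_weight_nonneg divide_left_mono) auto
    then have "gauss_weight 0 x * (1 / ((1 + x) * (1 + y))) * \<bar>x - y\<bar> \<le> gauss_weight 0 x * (1 / (1 + x)) * \<bar>x - y\<bar>"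
      by (rule mult_right_mono) simp
    then show ?thesis using True unfolding diff c_def by (simp add: algebra_simps)
  next
    case False
    have "2 * 2 \<le> (real k + 1 + x) * (real k + 1 + y)"
      using x y False by (intro mult_mono) auto
    then have "\<bar>x - y\<bar> / ((real k + 1 + x) * (real k + 1 + y)) \<le> \<bar>x - y\<bar> / 4"
      by (intro divide_left_mono) auto
    then have "gauss_weight k x * (\<bar>x - y\<bar> / ((real k + 1 + x) * (real k + 1 + y))) \<le> gauss_weight k x * (\<bar>x - y\<bar> / 4)"
      using gauss_weight_nonneg[OF x] by (intro mult_left_mono)
    then show ?thesis using False unfolding diff by simp
  qed
  have c0: "c \<ge> 0"
    unfolding c_def using x by (intro mult_nonneg_nonneg gauss_weight_nonneg) (auto simp: field_simps)
  have "(\<Sum>k<n. gauss_weight k x * \<bar>gauss_branch k x - gauss_branch k y\<bar>)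
      \<le> (\<Sum>k<n. (gauss_weight k x / 4 + (if k = 0 then c else 0)) * \<bar>x - y\<bar>)"
    by (rule sum_mono) (rule term_le)
  also have "\<dots> = ((\<Sum>k<n. gauss_weight k x) / 4 + (\<Sum>k<n. if k = 0 then c else 0)) * \<bar>x - y\<bar>"
    by (simp add: sum_distrib_right[symmetric] sum.distrib sum_divide_distrib)
  also have "\<dots> \<le> (1 / 4 + c) * \<bar>x - y\<bar>"
  proof (intro mult_right_mono add_mono)
    show "(\<Sum>k<n. gauss_weight k x) / 4 \<le> 1 / 4"
      using x by (simp add: sum_gauss_weight divide_le_eq)
    show "(\<Sum>k<n. if k = 0 then c else 0) \<le> c"
      using c0 by (simp add: sum.delta')
  qed simp
  also have "\<dots> \<le> 5 / 8 * \<bar>x - y\<bar>"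
  proof (intro mult_right_mono)
    have "gauss_weight 0 x = 1 / (2 + x)"
      using x by (simp add: gauss_weight_def divide_simps)
    also have "\<dots> \<le> 1 / 2" using x by (simp add: field_simps)
    finally have "c \<le> (3 / 4) * (1 / 2)"
      unfolding c_def using x by (intro mult_mono gauss_weight_nonneg) (auto simp: field_simps)
    then show "1 / 4 + c \<le> 5 / 8" by simp
  qed simp
  finally show ?thesis .
qed

lemma gauss_transfer_weight_part:
  fixes f :: "real \<Rightarrow> 'a::real_normed_vector"
  assumes f: "L-lipschitz_on {0..1} f" and x: "x \<in> {0..1}" and y: "y \<in> {0..1}"
  shows "norm (\<Sum>k<n. (gauss_weight k x - gauss_weight k y) *\<^sub>R f (gauss_branch k y))
      \<le> \<bar>real n / (real n + 1 + x) - real n / (real n + 1 + y)\<bar> * norm (f (gauss_branch n y))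
          + 5 / 24 * L * \<bar>x - y\<bar>"
proof -
  define D where "D n = real n / (real n + 1 + x) - real n / (real n + 1 + y)" for n
  have L: "L \<ge> 0" using f by (rule lipschitz_on_nonneg)
  have D_eq: "D n = (\<Sum>k<n. gauss_weight k x - gauss_weight k y)" for n
    by (simp add: D_def sum_subtractf sum_gauss_weight[OF x] sum_gauss_weight[OF y])
  have weight_eq: "gauss_weight k x - gauss_weight k y = D (Suc k) - D k" for k
    by (simp add: D_eq)
  have D_le: "\<bar>D (Suc k)\<bar> \<le> \<bar>x - y\<bar> * ((real k + 1) / (real k + 2)\<^sup>2)" for k
  proof -
    have "D (Suc k) = (y - x) * ((real k + 1) / ((real k + 2 + x) * (real k + 2 + y)))"
      using x y by (simp add: D_def divide_simps) (simp add: algebra_simps)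
    then have "\<bar>D (Suc k)\<bar> = \<bar>x - y\<bar> * ((real k + 1) / ((real k + 2 + x) * (real k + 2 + y)))"
      using x y by (simp add: abs_mult abs_divide abs_minus_commute)
    also have "\<dots> \<le> \<bar>x - y\<bar> * ((real k + 1) / (real k + 2)\<^sup>2)"
      using x y by (intro mult_left_mono divide_left_mono)
        (auto simp: power2_eq_square intro!: mult_mono mult_pos_pos)
    finally show ?thesis .
  qed
  have f_le: "norm (f (gauss_branch (Suc k) y) - f (gauss_branch k y)) \<le> L * (1 / ((real k + 1) * (real k + 2)))" for k
  proof -
    have "norm (f (gauss_branch (Suc k) y) - f (gauss_branch k y)) \<le> L * \<bar>gauss_branch (Suc k) y - gauss_branch k y\<bar>"
      using lipschitz_on_normD[OF f gauss_branch_mem[OF y] gauss_branch_mem[OF y]] by simp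
    also have "\<bar>gauss_branch (Suc k) y - gauss_branch k y\<bar> = 1 / ((real k + 1 + y) * (real k + 2 + y))"
    proof -
      have "gauss_branch (Suc k) y - gauss_branch k y = - (1 / ((real k + 1 + y) * (real k + 2 + y)))"
        using y by (simp add: gauss_branch_def divide_simps)
      then show ?thesis using y by simp
    qed
    also have "L * (1 / ((real k + 1 + y) * (real k + 2 + y))) \<le> L * (1 / ((real k + 1) * (real k + 2)))"
      using y L by (intro mult_left_mono divide_left_mono) (auto intro!: mult_mono mult_pos_pos)
    finally show ?thesis .
  qed
  have "(\<Sum>k<n. (gauss_weight k x - gauss_weight k y) *\<^sub>R f (gauss_branch k y))
      = D n *\<^sub>R f (gauss_branch n y) - (\<Sum>k<n. D (Suc k) *\<^sub>R (f (gauss_branch (Suc k) y) - f (gauss_branch k y)))"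
    unfolding weight_eq by (rule sum_by_parts_lessThan) (simp add: D_def)
  also have "norm \<dots> \<le> \<bar>D n\<bar> * norm (f (gauss_branch n y))
      + (\<Sum>k<n. \<bar>D (Suc k)\<bar> * norm (f (gauss_branch (Suc k) y) - f (gauss_branch k y)))"
    by (intro order_trans[OF norm_triangle_ineq4] add_mono order_trans[OF norm_sum]) auto
  also have "(\<Sum>k<n. \<bar>D (Suc k)\<bar> * norm (f (gauss_branch (Suc k) y) - f (gauss_branch k y)))
      \<le> (\<Sum>k<n. L * \<bar>x - y\<bar> * (1 / (real k + 2) ^ 3))"
  proof (rule sum_mono)
    fix k
    have "\<bar>D (Suc k)\<bar> * norm (f (gauss_branch (Suc k) y) - f (gauss_branch k y))
        \<le> (\<bar>x - y\<bar> * ((real k + 1) / (real k + 2)\<^sup>2)) * (L * (1 / ((real k + 1) * (real k + 2))))"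
      by (intro mult_mono D_le f_le) auto
    also have "\<dots> = L * \<bar>x - y\<bar> * (1 / (real k + 2) ^ 3)"
      by (simp add: divide_simps power2_eq_square power3_eq_cube)
    finally show "\<bar>D (Suc k)\<bar> * norm (f (gauss_branch (Suc k) y) - f (gauss_branch k y))
        \<le> L * \<bar>x - y\<bar> * (1 / (real k + 2) ^ 3)" .
  qed
  also have "\<dots> = L * \<bar>x - y\<bar> * (\<Sum>k<n. 1 / (real k + 2) ^ 3)"
    by (simp add: sum_distrib_left)
  also have "\<dots> \<le> L * \<bar>x - y\<bar> * (5 / 24)"
    using L by (intro mult_left_mono sum_inverse_cubes_le) auto
  finally show ?thesis by (simp add: D_def mult_ac)
qed

lemma lipschitz_on_unit_bounded:
  fixes f :: "real \<Rightarrow> 'a::real_normed_vector"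
  assumes "L-lipschitz_on {0..1} f" "x \<in> {0..1}"
  shows "norm (f x) \<le> norm (f 0) + L"
proof -
  have "norm (f x - f 0) \<le> L * norm (x - 0)"
    using assms by (intro lipschitz_on_normD) auto
  also have "\<dots> \<le> L * 1"
    using assms lipschitz_on_nonneg[OF assms(1)] by (intro mult_left_mono) auto
  finally show ?thesis using norm_triangle_ineq2[of "f x" "f 0"] by simp
qed

lemma lipschitz_gauss_transfer:
  fixes f :: "real \<Rightarrow> 'a::banach"
  assumes f: "L-lipschitz_on {0..1} f"
  shows "(5 / 6 * L)-lipschitz_on {0..1} (gauss_transfer f)"
proof (rule lipschitz_onI)
  have L: "L \<ge> 0" using f by (rule lipschitz_on_nonneg)
  then show "0 \<le> 5 / 6 * L" by simp
  fix x y :: real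
  assume x: "x \<in> {0..1}" and y: "y \<in> {0..1}"
  define B where "B = norm (f 0) + L"
  have B: "norm (f y) \<le> B" if "y \<in> {0..1}" for y
    unfolding B_def using lipschitz_on_unit_bounded[OF f that] .
  define S where "S n = (\<Sum>k<n. gauss_weight k x *\<^sub>R f (gauss_branch k x))
      - (\<Sum>k<n. gauss_weight k y *\<^sub>R f (gauss_branch k y))" for n
  define r where "r n = \<bar>real n / (real n + 1 + x) - real n / (real n + 1 + y)\<bar> * B" for n
  have "S \<longlonglongrightarrow> gauss_transfer f x - gauss_transfer f y"
    unfolding S_def gauss_transfer_def
    by (intro tendsto_diff summable_LIMSEQ summable_gauss_transfer[OF B] x y)
  moreover have "(\<lambda>n. 5 / 6 * L * \<bar>x - y\<bar> + r n) \<longlonglongrightarrow> 5 / 6 * L * \<bar>x - y\<bar> + 0"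
  proof (intro tendsto_add tendsto_const)
    have "(\<lambda>n. real n / (real n + 1 + x) - real n / (real n + 1 + y)) \<longlonglongrightarrow> 0"
      by real_asymp
    then show "r \<longlonglongrightarrow> 0"
      unfolding r_def by (intro tendsto_mult_left_zero tendsto_rabs_zero)
  qed
  moreover have "norm (S n) \<le> 5 / 6 * L * \<bar>x - y\<bar> + r n" for n
  proof -
    have "S n = (\<Sum>k<n. gauss_weight k x *\<^sub>R (f (gauss_branch k x) - f (gauss_branch k y)))
        + (\<Sum>k<n. (gauss_weight k x - gauss_weight k y) *\<^sub>R f (gauss_branch k y))"
      unfolding S_def sum.distrib[symmetric] sum_subtractf[symmetric]
      by (intro sum.cong) (auto simp: algebra_simps)
    also have "norm \<dots> \<le> (\<Sum>k<n. gauss_weight k x * (L * \<bar>gauss_branch k x - gauss_branch k y\<bar>))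
        + (r n + 5 / 24 * L * \<bar>x - y\<bar>)"
    proof (intro order_trans[OF norm_triangle_ineq] add_mono)
      show "norm (\<Sum>k<n. gauss_weight k x *\<^sub>R (f (gauss_branch k x) - f (gauss_branch k y)))
          \<le> (\<Sum>k<n. gauss_weight k x * (L * \<bar>gauss_branch k x - gauss_branch k y\<bar>))"
        using gauss_weight_nonneg[OF x]
          lipschitz_on_normD[OF f gauss_branch_mem[OF x] gauss_branch_mem[OF y]]
        by (intro order_trans[OF norm_sum] sum_mono) (auto intro!: mult_left_mono)
      have "\<bar>real n / (real n + 1 + x) - real n / (real n + 1 + y)\<bar> * norm (f (gauss_branch n y)) \<le> r n"
        unfolding r_def using B[OF gauss_branch_mem[OF y]] by (intro mult_left_mono) auto
      then show "norm (\<Sum>k<n. (gauss_weight k x - gauss_weight k y) *\<^sub>R f (gauss_branch k y))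
          \<le> r n + 5 / 24 * L * \<bar>x - y\<bar>"
        using gauss_transfer_weight_part[OF f x y, of n] by linarith
    qed
    also have "(\<Sum>k<n. gauss_weight k x * (L * \<bar>gauss_branch k x - gauss_branch k y\<bar>))
        = L * (\<Sum>k<n. gauss_weight k x * \<bar>gauss_branch k x - gauss_branch k y\<bar>)"
      by (simp add: sum_distrib_left mult_ac)
    also have "\<dots> \<le> L * (5 / 8 * \<bar>x - y\<bar>)"
      by (intro mult_left_mono gauss_transfer_branch_part x y L)
    finally show ?thesis by (simp add: algebra_simps)
  qed
  ultimately have "norm (gauss_transfer f x - gauss_transfer f y) \<le> 5 / 6 * L * \<bar>x - y\<bar> + 0"
    by (intro LIMSEQ_le[OF tendsto_norm]) auto
  then show "dist (gauss_transfer f x) (gauss_transfer f y) \<le> 5 / 6 * L * dist x y"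
    by (simp add: dist_norm)
qed

section \<open>Large digits\<close>

text \<open>The points whose first digit exceeds \<open>b\<close>.\<close>

definition large_digit :: "nat \<Rightarrow> real set" where
  "large_digit b = {0<..1 / (real b + 1)}"

text \<open>The transfer operator restricted to the branches with digit larger than \<open>b\<close>. On \<open>{0..<1}\<close>
  this is the transfer operator applied to the product with the indicator of
  \<^term>\<open>large_digit b\<close>; at \<open>1\<close>, where two branches share an image point, it is the continuous
  choice.\<close>

definition gauss_tail_transfer :: "nat \<Rightarrow> (real \<Rightarrow> 'a::banach) \<Rightarrow> real \<Rightarrow> 'a" where
  "gauss_tail_transfer b f x =
     (\<Sum>k. (if b \<le> k then gauss_weight k x else 0) *\<^sub>R f (gauss_branch k x))"

lemma floor_inverse_gt_iff:
  assumes "x \<in> {0..<1}"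
  shows "\<lfloor>1 / x\<rfloor> > int b \<longleftrightarrow> x \<in> large_digit b"
proof (cases "x = 0")
  case False
  then have "x > 0" using assms by simp
  have "\<lfloor>1 / x\<rfloor> > int b \<longleftrightarrow> real b + 1 \<le> 1 / x"
    using less_floor_iff[of "int b" "1 / x"] by simp
  then show ?thesis
    using \<open>x > 0\<close> by (auto simp: large_digit_def field_simps)
qed (simp add: large_digit_def)

lemma gauss_branch_large_digit_iff:
  assumes "x \<in> {0..<1}"
  shows "gauss_branch k x \<in> large_digit b \<longleftrightarrow> b \<le> k"
proof -
  have "gauss_branch k x \<in> large_digit b \<longleftrightarrow> real b \<le> real k + x"
    using assms by (auto simp: gauss_branch_def large_digit_def field_simps)
  also have "\<dots> \<longleftrightarrow> b \<le> k"
    using assms by auto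
  finally show ?thesis .
qed

lemma gauss_transfer_indicator_mult:
  assumes "x \<in> {0..<1}"
  shows "gauss_transfer (\<lambda>y. indicator (large_digit b) y *\<^sub>R f y) x = gauss_tail_transfer b f x"
  unfolding gauss_transfer_def gauss_tail_transfer_def
  by (intro suminf_cong) (auto simp: indicator_def gauss_branch_large_digit_iff[OF assms])

lemma norm_gauss_tail_transfer_term_le:
  fixes f :: "real \<Rightarrow> 'a::banach"
  assumes "\<And>y. y \<in> {0..1} \<Longrightarrow> norm (f y) \<le> B" and "x \<in> {0..1}"
  shows "norm ((if b \<le> k then gauss_weight k x else 0) *\<^sub>R f (gauss_branch k x)) \<le> gauss_weight k x * B"
proof -
  have "0 \<le> B" using assms(1)[of 0] by (force intro: order_trans[OF norm_ge_zero])
  then show ?thesis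
    using assms(1)[OF gauss_branch_mem[OF assms(2)]] gauss_weight_nonneg[OF assms(2)]
    by (auto intro!: mult_left_mono mult_nonneg_nonneg)
qed

lemma summable_gauss_tail_transfer:
  fixes f :: "real \<Rightarrow> 'a::banach"
  assumes "\<And>y. y \<in> {0..1} \<Longrightarrow> norm (f y) \<le> B" and "x \<in> {0..1}"
  shows "summable (\<lambda>k. (if b \<le> k then gauss_weight k x else 0) *\<^sub>R f (gauss_branch k x))"
proof (rule summable_comparison_test')
  show "summable (\<lambda>k. gauss_weight k x * B)"
    using sums_gauss_weight[OF assms(2)] by (intro summable_mult2) (rule sums_summable)
qed (rule norm_gauss_tail_transfer_term_le[OF assms])

lemma norm_gauss_tail_transfer_le:
  fixes f :: "real \<Rightarrow> 'a::banach"
  assumes "\<And>y. y \<in> {0..1} \<Longrightarrow> norm (f y) \<le> B" and "x \<in> {0..1}"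
  shows "norm (gauss_tail_transfer b f x) \<le> B"
proof -
  have s: "(\<lambda>k. gauss_weight k x * B) sums B"
    using sums_mult2[OF sums_gauss_weight[OF assms(2)], of B] by simp
  have "norm (gauss_tail_transfer b f x) \<le> (\<Sum>k. gauss_weight k x * B)"
    unfolding gauss_tail_transfer_def
    by (intro norm_suminf_le[OF norm_gauss_tail_transfer_term_le[OF assms]] sums_summable[OF s])
  then show ?thesis using s by (simp add: sums_iff)
qed

lemma gauss_tail_transfer_add:
  fixes f g :: "real \<Rightarrow> 'a::banach"
  assumes "\<And>y. y \<in> {0..1} \<Longrightarrow> norm (f y) \<le> B" "\<And>y. y \<in> {0..1} \<Longrightarrow> norm (g y) \<le> C"
    and "x \<in> {0..1}"
  shows "gauss_tail_transfer b (\<lambda>y. f y + g y) x = gauss_tail_transfer b f x + gauss_tail_transfer b g x"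
  unfolding gauss_tail_transfer_def
  by (subst suminf_add[OF summable_gauss_tail_transfer[of f, OF assms(1,3)]
        summable_gauss_tail_transfer[of g, OF assms(2,3)]]) (simp_all only: scaleR_add_right)

lemma gauss_tail_transfer_linear:
  fixes f :: "real \<Rightarrow> 'a::banach"
  assumes "bounded_linear T" "\<And>y. y \<in> {0..1} \<Longrightarrow> norm (f y) \<le> B" "x \<in> {0..1}"
  shows "gauss_tail_transfer b (\<lambda>y. T (f y)) x = T (gauss_tail_transfer b f x)"
proof -
  interpret T: bounded_linear T by fact
  show ?thesis
    unfolding gauss_tail_transfer_def
    by (subst T.suminf[OF summable_gauss_tail_transfer[of f, OF assms(2,3)]]) (simp_all only: T.scaleR)
qed

lemma gauss_tail_transfer_const:
  "x \<in> {0..1} \<Longrightarrow> gauss_tail_transfer b (\<lambda>_. c) x = ((1 + x) / (real b + 1 + x)) *\<^sub>R c"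
  using sums_scaleR_left[OF sums_gauss_weight_tail, of x b c]
  by (simp add: gauss_tail_transfer_def sums_iff)

lemma borel_measurable_gauss_tail_transfer [measurable]:
  fixes f :: "real \<Rightarrow> 'a::{banach,second_countable_topology}"
  assumes [measurable]: "f \<in> borel_measurable borel"
  shows "gauss_tail_transfer b f \<in> borel_measurable borel"
  unfolding gauss_tail_transfer_def by measurable

lemma sets_large_digit [measurable]: "large_digit b \<in> sets borel"
  unfolding large_digit_def by measurable

lemma gauss_weight_diff_le:
  assumes x: "x \<in> {0..1}" and y: "y \<in> {0..1}"
  shows "\<bar>gauss_weight k x - gauss_weight k y\<bar> \<le> 2 * gauss_weight k 0 * \<bar>x - y\<bar>"
proof -
  define D where "D z = (real k + 1 + z) * (real k + 2 + z)" for z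
  define N where "N = real k * (real k + 1) - (1 + x) * (1 + y)"
  have D0: "D 0 > 0" by (auto simp: D_def)
  have D_ge: "D z \<ge> D 0" if "z \<in> {0..1}" for z
    unfolding D_def using that by (intro mult_mono) auto
  have Dx: "D x > 0" and Dy: "D y > 0" using D_ge[OF x] D_ge[OF y] D0 by auto
  have "gauss_weight k x - gauss_weight k y = ((1 + x) * D y - (1 + y) * D x) / (D x * D y)"
    using Dx Dy unfolding gauss_weight_def D_def[symmetric] by (simp add: field_simps)
  also have "(1 + x) * D y - (1 + y) * D x = (x - y) * N"
    by (simp add: D_def N_def algebra_simps)
  finally have "\<bar>gauss_weight k x - gauss_weight k y\<bar> = \<bar>x - y\<bar> * \<bar>N\<bar> / (D x * D y)"
    using Dx Dy by (simp add: abs_mult abs_divide)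
  also have "\<dots> \<le> \<bar>x - y\<bar> * (2 * D 0) / (D 0 * D 0)"
  proof (intro frac_le mult_left_mono mult_mono D_ge x y)
    have "(1 + x) * (1 + y) \<le> 2 * 2" using x y by (intro mult_mono) auto
    moreover have "0 \<le> (1 + x) * (1 + y)" using x y by auto
    moreover have "4 \<le> 2 * D 0" "real k * (real k + 1) \<le> 2 * D 0" "0 \<le> real k * (real k + 1)"
      by (auto simp: D_def algebra_simps)
    ultimately show "\<bar>N\<bar> \<le> 2 * D 0" unfolding N_def by linarith
  qed (use D0 Dx Dy in auto)
  also have "\<dots> = 2 * (1 / D 0) * \<bar>x - y\<bar>"
    using D0 by simp
  also have "1 / D 0 = gauss_weight k 0"
    by (simp add: gauss_weight_def D_def)
  finally show ?thesis .
qed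

lemma lipschitz_gauss_tail_transfer:
  fixes f :: "real \<Rightarrow> 'a::banach"
  assumes f: "L-lipschitz_on {0..1} f" and B: "\<And>y. y \<in> {0..1} \<Longrightarrow> norm (f y) \<le> B" and b: "b \<ge> 1"
  shows "(L + B)-lipschitz_on {0..1} (gauss_tail_transfer b f)"
proof (rule lipschitz_onI)
  have L0: "L \<ge> 0" using f by (rule lipschitz_on_nonneg)
  have B0: "0 \<le> B" using B[of 0] by (force intro: order_trans[OF norm_ge_zero])
  show "0 \<le> L + B" using L0 B0 by simp
  fix x y :: real
  assume x: "x \<in> {0..1}" and y: "y \<in> {0..1}"
  define w where "w k x = (if b \<le> k then gauss_weight k x else 0)" for k x
  have w_sums: "(\<lambda>k. w k x) sums ((1 + x) / (real b + 1 + x))" if "x \<in> {0..1}" for x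
    unfolding w_def by (rule sums_gauss_weight_tail[OF that])
  have term_le: "norm (w k x *\<^sub>R f (gauss_branch k x) - w k y *\<^sub>R f (gauss_branch k y))
      \<le> w k x * (L * \<bar>x - y\<bar>) + w k 0 * (2 * B * \<bar>x - y\<bar>)" for k
  proof (cases "b \<le> k")
    case True
    have "(real k + 1 + x) * (real k + 1 + y) \<ge> 1 * 1"
      using x y by (intro mult_mono) auto
    moreover have "gauss_branch k x - gauss_branch k y = (y - x) / ((real k + 1 + x) * (real k + 1 + y))"
      using x y by (auto simp: gauss_branch_def divide_simps)
    ultimately have "\<bar>gauss_branch k x - gauss_branch k y\<bar> \<le> \<bar>x - y\<bar> / 1"
      by (simp only: abs_divide abs_minus_commute[of y]) (intro divide_left_mono, auto)
    then have "norm (f (gauss_branch k x) - f (gauss_branch k y)) \<le> L * \<bar>x - y\<bar>"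
      using lipschitz_on_normD[OF f gauss_branch_mem[OF x, of k] gauss_branch_mem[OF y, of k]] L0
      by (simp add: mult_left_mono order_trans)
    then have 1: "norm (gauss_weight k x *\<^sub>R (f (gauss_branch k x) - f (gauss_branch k y))) \<le> gauss_weight k x * (L * \<bar>x - y\<bar>)"
      using gauss_weight_nonneg[OF x] by (auto intro!: mult_left_mono)
    have 2: "norm ((gauss_weight k x - gauss_weight k y) *\<^sub>R f (gauss_branch k y)) \<le> (2 * gauss_weight k 0 * \<bar>x - y\<bar>) * B"
      using gauss_weight_diff_le[OF x y] B[OF gauss_branch_mem[OF y]] gauss_weight_nonneg[of 0 k]
      by (simp only: norm_scaleR real_norm_def) (intro mult_mono, auto)
    have "gauss_weight k x *\<^sub>R f (gauss_branch k x) - gauss_weight k y *\<^sub>R f (gauss_branch k y)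
        = gauss_weight k x *\<^sub>R (f (gauss_branch k x) - f (gauss_branch k y))
          + (gauss_weight k x - gauss_weight k y) *\<^sub>R f (gauss_branch k y)"
      by (simp add: algebra_simps)
    then show ?thesis
      using norm_triangle_le[OF add_mono[OF 1 2]] True by (simp add: w_def mult_ac)
  qed (simp add: w_def)
  have bound_sums: "(\<lambda>k. w k x * (L * \<bar>x - y\<bar>) + w k 0 * (2 * B * \<bar>x - y\<bar>))
      sums ((1 + x) / (real b + 1 + x) * (L * \<bar>x - y\<bar>) + (1 + 0) / (real b + 1 + 0) * (2 * B * \<bar>x - y\<bar>))"
    by (intro sums_add sums_mult2 w_sums x) auto
  have "gauss_tail_transfer b f x - gauss_tail_transfer b f y
      = (\<Sum>k. w k x *\<^sub>R f (gauss_branch k x) - w k y *\<^sub>R f (gauss_branch k y))"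
    unfolding gauss_tail_transfer_def w_def
    by (subst suminf_diff[OF summable_gauss_tail_transfer[of f, OF B x] summable_gauss_tail_transfer[of f, OF B y]]) auto
  also have "norm \<dots> \<le> (\<Sum>k. w k x * (L * \<bar>x - y\<bar>) + w k 0 * (2 * B * \<bar>x - y\<bar>))"
    by (intro norm_suminf_le[OF term_le] sums_summable[OF bound_sums])
  also have "\<dots> = (1 + x) / (real b + 1 + x) * (L * \<bar>x - y\<bar>) + 2 / (real b + 1) * (B * \<bar>x - y\<bar>)"
    using bound_sums by (simp add: sums_iff mult_ac)
  also have "\<dots> \<le> 1 * (L * \<bar>x - y\<bar>) + 1 * (B * \<bar>x - y\<bar>)"
    using x b L0 B0 by (intro add_mono mult_right_mono) (auto simp: field_simps)
  finally show "dist (gauss_tail_transfer b f x) (gauss_tail_transfer b f y) \<le> (L + B) * dist x y"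
    by (simp add: dist_norm algebra_simps)
qed

lemma lipschitz_gauss_tail_transfer_one:
  assumes "b \<ge> 1"
  shows "(1 / 4)-lipschitz_on {0..1} (gauss_tail_transfer b (\<lambda>_. 1 :: real))"
proof (rule lipschitz_onI)
  fix x y :: real
  assume x: "x \<in> {0..1}" and y: "y \<in> {0..1}"
  have "4 * real b \<le> (real b + 1) * (real b + 1)"
    using zero_le_square[of "real b - 1"] by (simp add: algebra_simps)
  also have "\<dots> \<le> (real b + 1 + x) * (real b + 1 + y)"
    using x y by (intro mult_mono) auto
  finally have le: "real b / ((real b + 1 + x) * (real b + 1 + y)) \<le> 1 / 4"
    using x y by (simp add: divide_le_eq)
  have "(1 + x) / (real b + 1 + x) - (1 + y) / (real b + 1 + y)
      = (x - y) * (real b / ((real b + 1 + x) * (real b + 1 + y)))"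
    using x y by (simp add: divide_simps) (simp add: algebra_simps)
  also have "\<bar>\<dots>\<bar> \<le> \<bar>x - y\<bar> * (1 / 4)"
    using le x y unfolding abs_mult by (intro mult_left_mono) auto
  finally show "dist (gauss_tail_transfer b (\<lambda>_. 1 :: real) x) (gauss_tail_transfer b (\<lambda>_. 1) y) \<le> 1 / 4 * dist x y"
    using x y by (simp add: gauss_tail_transfer_const dist_norm)
qed simp

section \<open>Invariance and duality\<close>

lemma space_gauss_measure [simp]: "space gauss_measure = {0..<1}"
  by (simp add: gauss_measure_def space_restrict_space)

lemma sets_gauss_measure: "sets gauss_measure = sets (restrict_space lborel {0..<1})"
  by (simp add: gauss_measure_def)

lemma borel_measurable_gauss_measure [measurable_dest]:
  "f \<in> borel_measurable borel \<Longrightarrow> f \<in> borel_measurable gauss_measure"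
  by (subst measurable_cong_sets[OF sets_gauss_measure refl]) (rule measurable_restrict_space1, simp)

lemma nn_integral_gauss_measure:
  assumes [measurable]: "f \<in> borel_measurable borel"
  shows "(\<integral>\<^sup>+x. f x \<partial>gauss_measure)
    = (\<integral>\<^sup>+x. ennreal (1 / ((x + 1) * ln 2)) * f x * indicator {0..<1} x \<partial>lborel)"
proof -
  have "(\<lambda>x. ennreal (1 / ((x + 1) * ln 2))) \<in> borel_measurable (restrict_space lborel {0..<1})"
    "f \<in> borel_measurable (restrict_space lborel {0..<1})"
    by (auto intro: measurable_restrict_space1)
  then show ?thesis
    unfolding gauss_measure_def by (simp add: nn_integral_density nn_integral_restrict_space)
qed

lemma disjoint_digit_intervals:
  "disjoint_family (\<lambda>k. {1 / (real k + 2)<..1 / (real k + 1)})"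
  unfolding disjoint_family_on_def
proof (intro ballI impI)
  fix m n :: nat
  have "{1 / (real m + 2)<..1 / (real m + 1)} \<inter> {1 / (real n + 2)<..1 / (real n + 1)} = {}"
    if "m < n" for m n
  proof -
    have "1 / (real n + 1) \<le> 1 / (real m + 2)"
      using that by (intro divide_left_mono) auto
    then show ?thesis by auto
  qed
  moreover assume "m \<noteq> n"
  ultimately show "{1 / (real m + 2)<..1 / (real m + 1)} \<inter> {1 / (real n + 2)<..1 / (real n + 1)} = {}"
    by (metis Int_commute linorder_neqE_nat)
qed

lemma digit_interval_exists:
  assumes "0 < x" "x < (1::real)"
  shows "\<exists>k. x \<in> {1 / (real k + 2)<..1 / (real k + 1)}"
proof -
  define k where "k = nat (\<lfloor>1 / x\<rfloor> - 1)"
  have "1 / x \<ge> 1" using assms by (simp add: field_simps)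
  then have "\<lfloor>1 / x\<rfloor> \<ge> 1" by simp
  then have "real k + 1 = of_int \<lfloor>1 / x\<rfloor>" by (simp add: k_def)
  then have "real k + 1 \<le> 1 / x" "1 / x < real k + 2"
    using of_int_floor_le[of "1 / x"] floor_correct[of "1 / x"] by linarith+
  then show ?thesis using assms by (intro exI[of _ k]) (auto simp: field_simps)
qed

lemma nn_integral_gauss_transfer_terms:
  fixes f :: "real \<Rightarrow> real"
  assumes [measurable]: "f \<in> borel_measurable borel"
  shows "(\<integral>\<^sup>+x. ennreal (f x) \<partial>gauss_measure)
    = (\<Sum>k. \<integral>\<^sup>+x. ennreal (gauss_weight k x * f (gauss_branch k x)) \<partial>gauss_measure)"
proof -
  define h where "h x = 1 / ((x + 1) * ln 2)" for x :: real
  have [measurable]: "h \<in> borel_measurable borel" unfolding h_def by measurable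
  have h_nonneg: "0 \<le> h x" if "0 \<le> x" for x using that by (simp add: h_def)
  have branch: "(\<integral>\<^sup>+x. ennreal (h x * f x) * indicator {1 / (real k + 2)<..1 / (real k + 1)} x \<partial>lborel)
      = (\<integral>\<^sup>+x. ennreal (gauss_weight k x * f (gauss_branch k x)) \<partial>gauss_measure)" for k
  proof -
    \<comment> \<open>The inverse branch is decreasing; composed with the reflection of the unit interval
        it becomes increasing, as the substitution rule requires.\<close>
    define g where "g y = 1 / (real k + 2 - y)" for y
    define g' where "g' y = 1 / (real k + 2 - y)\<^sup>2" for y
    have [measurable]: "g \<in> borel_measurable borel" "g' \<in> borel_measurable borel"
      unfolding g_def g'_def by measurable
    have "(\<integral>\<^sup>+x. ennreal (h x * f x) * indicator {1 / (real k + 2)<..1 / (real k + 1)} x \<partial>lborel)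
        = (\<integral>\<^sup>+x. ennreal (h x * f x * indicator {g 0..g 1} x) \<partial>lborel)"
      by (intro nn_integral_cong_AE AE_I[where N = "{1 / (real k + 2)}"])
         (auto simp: indicator_def g_def add.commute)
    also have "\<dots> = (\<integral>\<^sup>+y. ennreal (h (g y) * f (g y) * g' y * indicator {0..1} y) \<partial>lborel)"
    proof (rule nn_integral_substitution)
      show "set_borel_measurable borel {g 0..g 1} (\<lambda>x. h x * f x)"
        unfolding set_borel_measurable_def by measurable
      show "continuous_on {0..1} g'"
        unfolding g'_def by (intro continuous_intros) auto
      show "(g has_real_derivative g' y) (at y)" if "y \<in> {0..1}" for y
        unfolding g_def g'_def using that
        by (auto intro!: derivative_eq_intros simp: power2_eq_square)
    qed (auto simp: g'_def)
    also have "\<dots> = ennreal \<bar>-1\<bar> * (\<integral>\<^sup>+y. ennreal (h (g (1 + -1 * y)) * f (g (1 + -1 * y)) * g' (1 + -1 * y)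
        * indicator {0..1} (1 + -1 * y)) \<partial>lborel)"
      by (rule nn_integral_real_affine) auto
    also have "\<dots> = (\<integral>\<^sup>+y. ennreal (h y) * ennreal (gauss_weight k y * f (gauss_branch k y)) * indicator {0..<1} y \<partial>lborel)"
    proof -
      have eq: "h (g (1 - y)) * f (g (1 - y)) * g' (1 - y) = h y * (gauss_weight k y * f (gauss_branch k y))"
        if "y \<in> {0..1}" for y
      proof -
        have "g (1 - y) = gauss_branch k y" by (simp add: g_def gauss_branch_def algebra_simps)
        moreover have "h (gauss_branch k y) * g' (1 - y) = h y * gauss_weight k y"
        proof -
          have "real k + 2 - (1 - y) = real k + 1 + y" by simp
          then have "h (gauss_branch k y) * g' (1 - y)
              = 1 / ((1 / (real k + 1 + y) + 1) * ln 2) * (1 / (real k + 1 + y)\<^sup>2)"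
            by (simp only: h_def g'_def gauss_branch_def)
          also have "\<dots> = 1 / ((real k + 1 + y) * (real k + 2 + y) * ln 2)"
          proof -
            have "1 / ((1 / z + 1) * l) * (1 / z\<^sup>2) = 1 / (z * (z + 1) * l)" if "z > 0" for z l :: real
            proof -
              have "1 / z + 1 = (z + 1) / z" using that by (simp add: field_simps)
              then show ?thesis using that by (simp add: power2_eq_square)
            qed
            from this[of "real k + 1 + y" "ln 2"] show ?thesis
              using that by (simp add: add_ac)
          qed
          also have "\<dots> = h y * gauss_weight k y"
            using that by (simp add: h_def gauss_weight_def divide_simps)
          finally show ?thesis .
        qed
        ultimately show ?thesis by (simp add: mult_ac)
      qed
      have "ennreal (h (g (1 - y)) * f (g (1 - y)) * g' (1 - y) * indicator {0..1} (1 - y))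
          = ennreal (h y) * ennreal (gauss_weight k y * f (gauss_branch k y)) * indicator {0..<1} y"
        if "y \<noteq> 1" for y
        using eq[of y] h_nonneg[of y] that
        by (auto simp: indicator_def ennreal_mult')
      then show ?thesis
        by (simp del: ennreal_mult') (intro nn_integral_cong_AE AE_I[where N = "{1}"], auto)
    qed
    also have "\<dots> = (\<integral>\<^sup>+x. ennreal (gauss_weight k x * f (gauss_branch k x)) \<partial>gauss_measure)"
      unfolding h_def by (rule nn_integral_gauss_measure[symmetric]) measurable
    finally show ?thesis .
  qed
  have "(\<integral>\<^sup>+x. ennreal (f x) \<partial>gauss_measure) = (\<integral>\<^sup>+x. ennreal (h x) * ennreal (f x) * indicator {0..<1} x \<partial>lborel)"
    unfolding h_def by (rule nn_integral_gauss_measure) measurable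
  also have "\<dots> = (\<integral>\<^sup>+x. (\<Sum>k. ennreal (h x * f x) * indicator {1 / (real k + 2)<..1 / (real k + 1)} x) \<partial>lborel)"
  proof (rule nn_integral_cong_AE)
    have "ennreal (h x) * ennreal (f x) * indicator {0..<1} x
        = (\<Sum>k. ennreal (h x * f x) * indicator {1 / (real k + 2)<..1 / (real k + 1)} x)" if "x \<notin> {0, 1}" for x
    proof (cases "0 < x \<and> x < 1")
      case True
      then obtain k where "x \<in> {1 / (real k + 2)<..1 / (real k + 1)}"
        using digit_interval_exists by blast
      from suminf_cmult_indicator[OF disjoint_digit_intervals this, of "\<lambda>_. ennreal (h x * f x)"]
      show ?thesis
        using True ennreal_mult'[OF h_nonneg, of x "f x"] by simp
    next
      case False
      have "x \<notin> {1 / (real k + 2)<..1 / (real k + 1)}" for k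
      proof
        assume *: "x \<in> {1 / (real k + 2)<..1 / (real k + 1)}"
        have "1 / (real k + 1) \<le> 1" "0 < 1 / (real k + 2)" by auto
        with * have "0 < x" "x \<le> 1"
          by (meson greaterThanAtMost_iff less_trans order_trans)+
        with False that show False by auto
      qed
      then have "(indicator {1 / (real k + 2)<..1 / (real k + 1)} x :: ennreal) = 0" for k
        by (rule indicator_simps)
      moreover have "x \<notin> {0..<1}" using False that by auto
      ultimately show ?thesis by (simp del: indicator_simps add: indicator_simps(2))
    qed
    moreover have "AE x in lborel. x \<notin> {0, 1::real}"
      by (intro AE_not_in countable_imp_null_set_lborel) auto
    ultimately show "AE x in lborel. ennreal (h x) * ennreal (f x) * indicator {0..<1} x
        = (\<Sum>k. ennreal (h x * f x) * indicator {1 / (real k + 2)<..1 / (real k + 1)} x)"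
      by (rule eventually_mono[rotated])
  qed
  also have "\<dots> = (\<Sum>k. \<integral>\<^sup>+x. ennreal (h x * f x) * indicator {1 / (real k + 2)<..1 / (real k + 1)} x \<partial>lborel)"
    by (intro nn_integral_suminf) auto
  also have "\<dots> = (\<Sum>k. \<integral>\<^sup>+x. ennreal (gauss_weight k x * f (gauss_branch k x)) \<partial>gauss_measure)"
    by (simp only: branch)
  finally show ?thesis .
qed

text \<open>Boundedness is only required on \<open>{0..1}\<close>, which contains all orbits of the Gauss map
  and its inverse branches.\<close>

definition bounded_borel :: "(real \<Rightarrow> 'a::real_normed_vector) \<Rightarrow> bool" where
  "bounded_borel f \<longleftrightarrow> f \<in> borel_measurable borel \<and> (\<exists>B. \<forall>x\<in>{0..1}. norm (f x) \<le> B)"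

lemma bounded_borelI:
  "f \<in> borel_measurable borel \<Longrightarrow> (\<And>x. x \<in> {0..1} \<Longrightarrow> norm (f x) \<le> B) \<Longrightarrow> bounded_borel f"
  unfolding bounded_borel_def by blast

lemma bounded_borelE:
  assumes "bounded_borel f"
  obtains B where "f \<in> borel_measurable borel" "\<And>x. x \<in> {0..1} \<Longrightarrow> norm (f x) \<le> B"
  using assms unfolding bounded_borel_def by blast

named_theorems bounded_borel_intros

lemma bounded_borel_measurable [measurable_dest]: "bounded_borel f \<Longrightarrow> f \<in> borel_measurable borel"
  by (simp add: bounded_borel_def)

lemma bounded_borel_const [bounded_borel_intros]: "bounded_borel (\<lambda>_. c)"
  by (rule bounded_borelI[of _ "norm c"]) auto

lemma bounded_borel_add [bounded_borel_intros]:
  fixes f g :: "real \<Rightarrow> 'a::{real_normed_vector,second_countable_topology}"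
  assumes "bounded_borel f" "bounded_borel g"
  shows "bounded_borel (\<lambda>x. f x + g x)"
proof -
  obtain B C where "f \<in> borel_measurable borel" "\<And>x. x \<in> {0..1} \<Longrightarrow> norm (f x) \<le> B"
    "g \<in> borel_measurable borel" "\<And>x. x \<in> {0..1} \<Longrightarrow> norm (g x) \<le> C"
    using assms by (metis bounded_borelE)
  then show ?thesis
    by (intro bounded_borelI[of _ "B + C"]) (auto intro!: norm_triangle_mono)
qed

lemma bounded_borel_mult [bounded_borel_intros]:
  fixes f g :: "real \<Rightarrow> 'a::{real_normed_algebra,second_countable_topology}"
  assumes "bounded_borel f" "bounded_borel g"
  shows "bounded_borel (\<lambda>x. f x * g x)"
proof -
  obtain B C where "f \<in> borel_measurable borel" "\<And>x. x \<in> {0..1} \<Longrightarrow> norm (f x) \<le> B"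
    "g \<in> borel_measurable borel" "\<And>x. x \<in> {0..1} \<Longrightarrow> norm (g x) \<le> C"
    using assms by (metis bounded_borelE)
  then show ?thesis
    by (intro bounded_borelI[of _ "B * C"] borel_measurable_times)
       (auto intro!: order_trans[OF norm_mult_ineq] mult_mono order_trans[OF norm_ge_zero])
qed

lemma bounded_borel_minus [bounded_borel_intros]:
  fixes f :: "real \<Rightarrow> 'a::{real_normed_vector,second_countable_topology}"
  shows "bounded_borel f \<Longrightarrow> bounded_borel (\<lambda>x. - f x)"
  by (auto simp: bounded_borel_def)

lemma bounded_borel_diff [bounded_borel_intros]:
  fixes f g :: "real \<Rightarrow> 'a::{real_normed_vector,second_countable_topology}"
  shows "bounded_borel f \<Longrightarrow> bounded_borel g \<Longrightarrow> bounded_borel (\<lambda>x. f x - g x)"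
  using bounded_borel_add[of f "\<lambda>x. - g x"] bounded_borel_minus[of g] by simp

lemma bounded_borel_power [bounded_borel_intros]:
  fixes f :: "real \<Rightarrow> 'a::{real_normed_algebra_1,second_countable_topology}"
  shows "bounded_borel f \<Longrightarrow> bounded_borel (\<lambda>x. f x ^ n)"
  by (induction n) (auto intro: bounded_borel_intros)

lemma bounded_borel_sum [bounded_borel_intros]:
  fixes f :: "'b \<Rightarrow> real \<Rightarrow> 'a::{real_normed_vector,second_countable_topology}"
  shows "(\<And>i. i \<in> A \<Longrightarrow> bounded_borel (f i)) \<Longrightarrow> bounded_borel (\<lambda>x. \<Sum>i\<in>A. f i x)"
  by (induction A rule: infinite_finite_induct) (auto intro: bounded_borel_intros)

lemma bounded_borel_indicator [bounded_borel_intros]: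
  "A \<in> sets borel \<Longrightarrow> bounded_borel (indicator A :: real \<Rightarrow> real)"
  by (rule bounded_borelI[of _ 1]) (auto simp: indicator_def)

lemma bounded_borel_of_real [bounded_borel_intros]:
  fixes f :: "real \<Rightarrow> real"
  shows "bounded_borel f \<Longrightarrow> bounded_borel (\<lambda>x. complex_of_real (f x))"
  by (auto simp: bounded_borel_def)

lemma bounded_borel_cis [bounded_borel_intros]:
  "f \<in> borel_measurable borel \<Longrightarrow> bounded_borel (\<lambda>x. cis (f x))"
  by (rule bounded_borelI[of _ 1]) (auto simp: cis_conv_exp)

lemma gauss_map_mem: "gauss_map x \<in> {0..<1}"
  using frac_lt_1[of "1 / x"] frac_ge_0[of "1 / x"] by (simp add: gauss_map_def frac_def)

text \<open>Not an introduction rule, because \<open>\<lambda>x. f (gauss_map x)\<close> with schematic \<open>f\<close> unifies with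
  every constant function.\<close>

lemma bounded_borel_gauss_map:
  assumes "bounded_borel f"
  shows "bounded_borel (\<lambda>x. f (gauss_map x))"
proof -
  obtain B where [measurable]: "f \<in> borel_measurable borel" and "\<And>x. x \<in> {0..1} \<Longrightarrow> norm (f x) \<le> B"
    using bounded_borelE[OF assms] by metis
  then show ?thesis
    using gauss_map_mem by (intro bounded_borelI[of _ B]) (auto simp: less_imp_le)
qed

lemma bounded_borel_gauss_transfer [bounded_borel_intros]:
  fixes f :: "real \<Rightarrow> 'a::{banach,second_countable_topology}"
  assumes "bounded_borel f"
  shows "bounded_borel (gauss_transfer f)"
  using bounded_borelE[OF assms]
  by (metis bounded_borelI borel_measurable_gauss_transfer norm_gauss_transfer_le)

lemma bounded_borel_gauss_tail_transfer [bounded_borel_intros]: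
  fixes f :: "real \<Rightarrow> 'a::{banach,second_countable_topology}"
  assumes "bounded_borel f"
  shows "bounded_borel (gauss_tail_transfer b f)"
  using bounded_borelE[OF assms]
  by (metis bounded_borelI borel_measurable_gauss_tail_transfer norm_gauss_tail_transfer_le)

lemma integrable_bounded_borel:
  fixes f :: "real \<Rightarrow> 'a::{banach,second_countable_topology}"
  assumes "bounded_borel f"
  shows "integrable gauss_measure f"
proof -
  obtain B where "f \<in> borel_measurable borel" "\<And>x. x \<in> {0..1} \<Longrightarrow> norm (f x) \<le> B"
    using bounded_borelE[OF assms] by metis
  then show ?thesis
    by (intro gauss.integrable_const_bound[of _ B] AE_I2) auto
qed

lemma integral_gauss_transfer_nonneg:
  fixes f :: "real \<Rightarrow> real"
  assumes f: "bounded_borel f" and nonneg: "\<And>x. x \<in> {0..1} \<Longrightarrow> 0 \<le> f x"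
  shows "(\<integral>x. gauss_transfer f x \<partial>gauss_measure) = (\<integral>x. f x \<partial>gauss_measure)"
proof -
  obtain B where [measurable]: "f \<in> borel_measurable borel" and B: "\<And>x. x \<in> {0..1} \<Longrightarrow> norm (f x) \<le> B"
    using bounded_borelE[OF f] by metis
  have term_nonneg: "0 \<le> gauss_weight k x * f (gauss_branch k x)" if "x \<in> {0..1}" for k x
    using gauss_weight_nonneg[OF that] nonneg[OF gauss_branch_mem[OF that]] by simp
  have ennreal_eq: "ennreal (gauss_transfer f x) = (\<Sum>k. ennreal (gauss_weight k x * f (gauss_branch k x)))"
    if "x \<in> {0..1}" for x
    using suminf_ennreal2[OF term_nonneg[OF that], of "\<lambda>k. k"] summable_gauss_transfer[of f, OF B that]
    by (simp add: gauss_transfer_def)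
  have transfer_nonneg: "0 \<le> gauss_transfer f x" if "x \<in> {0..1}" for x
    unfolding gauss_transfer_def
    using suminf_nonneg[OF summable_gauss_transfer[of f, OF B that]] term_nonneg[OF that] by simp
  have "ennreal (\<integral>x. f x \<partial>gauss_measure) = (\<integral>\<^sup>+x. ennreal (f x) \<partial>gauss_measure)"
    using nonneg by (intro nn_integral_eq_integral[symmetric] integrable_bounded_borel f AE_I2) auto
  also have "\<dots> = (\<Sum>k. \<integral>\<^sup>+x. ennreal (gauss_weight k x * f (gauss_branch k x)) \<partial>gauss_measure)"
    by (rule nn_integral_gauss_transfer_terms) measurable
  also have "\<dots> = (\<integral>\<^sup>+x. (\<Sum>k. ennreal (gauss_weight k x * f (gauss_branch k x))) \<partial>gauss_measure)"
    by (intro nn_integral_suminf[symmetric]) auto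
  also have "\<dots> = (\<integral>\<^sup>+x. ennreal (gauss_transfer f x) \<partial>gauss_measure)"
    by (intro nn_integral_cong ennreal_eq[symmetric]) auto
  also have "\<dots> = ennreal (\<integral>x. gauss_transfer f x \<partial>gauss_measure)"
    using transfer_nonneg
    by (intro nn_integral_eq_integral integrable_bounded_borel bounded_borel_intros f AE_I2) auto
  finally show ?thesis
    by (subst (asm) ennreal_inj) (auto intro!: integral_nonneg_AE AE_I2 nonneg transfer_nonneg)
qed

lemma integral_gauss_transfer:
  fixes f :: "real \<Rightarrow> 'a::euclidean_space"
  assumes f: "bounded_borel f"
  shows "(\<integral>x. gauss_transfer f x \<partial>gauss_measure) = (\<integral>x. f x \<partial>gauss_measure)"
proof (rule euclidean_eqI)
  fix i :: 'a assume i: "i \<in> Basis"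
  obtain B where [measurable]: "f \<in> borel_measurable borel" and B: "\<And>x. x \<in> {0..1} \<Longrightarrow> norm (f x) \<le> B"
    using bounded_borelE[OF f] by metis
  have Bi: "norm (f x \<bullet> i) \<le> B" if "x \<in> {0..1}" for x
    using B[OF that] norm_Basis[OF i] Cauchy_Schwarz_ineq2[of "f x" i] by simp
  have fi: "bounded_borel (\<lambda>x. f x \<bullet> i)"
    by (rule bounded_borelI[of _ B]) (use Bi in auto)
  have "(\<integral>x. gauss_transfer (\<lambda>x. f x \<bullet> i + B) x \<partial>gauss_measure) = (\<integral>x. f x \<bullet> i + B \<partial>gauss_measure)"
    by (intro integral_gauss_transfer_nonneg bounded_borel_intros fi)
       (use Bi in \<open>fastforce simp: abs_le_iff\<close>)
  moreover have "gauss_transfer (\<lambda>x. f x \<bullet> i + B) x = gauss_transfer f x \<bullet> i + B" if "x \<in> {0..1}" for x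
    using gauss_transfer_add[of "\<lambda>x. f x \<bullet> i" B "\<lambda>_. B" "norm B" x] Bi
      gauss_transfer_linear[of "\<lambda>z. z \<bullet> i", OF bounded_linear_inner_left B that] that by simp
  ultimately have "(\<integral>x. gauss_transfer f x \<bullet> i + B \<partial>gauss_measure) = (\<integral>x. f x \<bullet> i + B \<partial>gauss_measure)"
    by (subst (asm) Bochner_Integration.integral_cong[OF refl, of gauss_measure _ "\<lambda>x. gauss_transfer f x \<bullet> i + B"]) auto
  then show "(\<integral>x. gauss_transfer f x \<partial>gauss_measure) \<bullet> i = (\<integral>x. f x \<partial>gauss_measure) \<bullet> i"
    by (simp add: integrable_bounded_borel f fi bounded_borel_gauss_transfer)
qed

text \<open>The transfer operator is dual to the composition with the Gauss map.\<close>

lemma integral_mult_gauss_map: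
  fixes f h :: "real \<Rightarrow> 'a::{euclidean_space,real_normed_field}"
  assumes f: "bounded_borel f" and h: "bounded_borel h"
  shows "(\<integral>x. f x * h (gauss_map x) \<partial>gauss_measure) = (\<integral>x. gauss_transfer f x * h x \<partial>gauss_measure)"
proof -
  obtain B where B: "\<And>x. x \<in> {0..1} \<Longrightarrow> norm (f x) \<le> B"
    using bounded_borelE[OF f] by metis
  have "(\<integral>x. f x * h (gauss_map x) \<partial>gauss_measure)
      = (\<integral>x. gauss_transfer (\<lambda>y. f y * h (gauss_map y)) x \<partial>gauss_measure)"
    by (rule integral_gauss_transfer[symmetric]) (intro bounded_borel_mult f bounded_borel_gauss_map[OF h])
  also have "\<dots> = (\<integral>x. gauss_transfer f x * h x \<partial>gauss_measure)"
    by (intro Bochner_Integration.integral_cong refl gauss_transfer_pull_out[OF B]) auto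
  finally show ?thesis .
qed

lemma integral_gauss_map:
  fixes h :: "real \<Rightarrow> 'a::{euclidean_space,real_normed_field}"
  assumes "bounded_borel h"
  shows "(\<integral>x. h (gauss_map x) \<partial>gauss_measure) = (\<integral>x. h x \<partial>gauss_measure)"
proof -
  have "(\<integral>x. 1 * h (gauss_map x) \<partial>gauss_measure) = (\<integral>x. gauss_transfer (\<lambda>_. 1) x * h x \<partial>gauss_measure)"
    by (intro integral_mult_gauss_map bounded_borel_intros assms)
  also have "\<dots> = (\<integral>x. 1 * h x \<partial>gauss_measure)"
    by (intro Bochner_Integration.integral_cong) auto
  finally show ?thesis by simp
qed

lemma bounded_borel_scaleR_indicator [bounded_borel_intros]:
  fixes f :: "real \<Rightarrow> 'a::{real_normed_vector,second_countable_topology}"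
  assumes "bounded_borel f"
  shows "bounded_borel (\<lambda>x. indicator (large_digit k) x *\<^sub>R f x)"
proof -
  obtain B where [measurable]: "f \<in> borel_measurable borel" and B: "\<And>x. x \<in> {0..1} \<Longrightarrow> norm (f x) \<le> B"
    using bounded_borelE[OF assms] by metis
  show ?thesis
    by (rule bounded_borelI[of _ B]) (use B in \<open>auto simp: indicator_def intro: order_trans[OF norm_ge_zero]\<close>)
qed

lemma integral_large_digit_mult_gauss_map:
  fixes f h :: "real \<Rightarrow> 'a::{euclidean_space,real_normed_field}"
  assumes f: "bounded_borel f" and h: "bounded_borel h"
  shows "(\<integral>x. (indicator (large_digit b) x *\<^sub>R f x) * h (gauss_map x) \<partial>gauss_measure)
    = (\<integral>x. gauss_tail_transfer b f x * h x \<partial>gauss_measure)"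
proof -
  have "(\<integral>x. (indicator (large_digit b) x *\<^sub>R f x) * h (gauss_map x) \<partial>gauss_measure)
      = (\<integral>x. gauss_transfer (\<lambda>x. indicator (large_digit b) x *\<^sub>R f x) x * h x \<partial>gauss_measure)"
    by (intro integral_mult_gauss_map bounded_borel_scaleR_indicator f h)
  also have "\<dots> = (\<integral>x. gauss_tail_transfer b f x * h x \<partial>gauss_measure)"
    by (intro Bochner_Integration.integral_cong refl) (simp add: gauss_transfer_indicator_mult)
  finally show ?thesis .
qed

section \<open>Centred counts and their variance\<close>

lemma funpow_gauss_map_mem: "x \<in> {0..<1} \<Longrightarrow> (gauss_map ^^ n) x \<in> {0..<1}"
  by (induction n) (simp_all only: funpow.simps o_apply id_apply gauss_map_mem)

lemma bounded_borel_funpow_gauss_map: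
  assumes "bounded_borel f"
  shows "bounded_borel (\<lambda>x. f ((gauss_map ^^ n) x))"
  using assms
proof (induction n arbitrary: f)
  case (Suc n)
  from Suc.IH[OF bounded_borel_gauss_map[OF Suc.prems]] show ?case by simp
qed simp

lemmas bounded_borel_indicator_gauss_map [bounded_borel_intros] =
  bounded_borel_gauss_map[OF bounded_borel_indicator]
  bounded_borel_funpow_gauss_map[OF bounded_borel_indicator]

lemma integral_funpow_gauss_map:
  fixes h :: "real \<Rightarrow> 'a::{euclidean_space,real_normed_field}"
  assumes "bounded_borel h"
  shows "(\<integral>x. h ((gauss_map ^^ n) x) \<partial>gauss_measure) = (\<integral>x. h x \<partial>gauss_measure)"
  using assms
proof (induction n arbitrary: h)
  case (Suc n)
  from Suc.IH[OF bounded_borel_gauss_map[OF Suc.prems]] integral_gauss_map[OF Suc.prems]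
  show ?case by simp
qed simp

lemma norm_le_lipschitz_mean_zero:
  fixes f :: "real \<Rightarrow> 'a::{banach,second_countable_topology}"
  assumes lip: "L-lipschitz_on {0..1} f" and f: "bounded_borel f"
    and zero: "(\<integral>x. f x \<partial>gauss_measure) = 0" and x: "x \<in> {0..1}"
  shows "norm (f x) \<le> L"
proof -
  have "norm (f x - f y) \<le> L" if "y \<in> {0..<1}" for y
  proof -
    have "norm (f x - f y) \<le> L * norm (x - y)"
      using lip x that by (intro lipschitz_on_normD) auto
    also have "\<dots> \<le> L * 1"
      using x that lipschitz_on_nonneg[OF lip] by (intro mult_left_mono) (auto simp: abs_le_iff)
    finally show ?thesis by simp
  qed
  then have "norm (\<integral>y. f x - f y \<partial>gauss_measure) \<le> (\<integral>y. L \<partial>gauss_measure)"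
    by (intro Bochner_Integration.integral_norm_bound_integral integrable_bounded_borel
        bounded_borel_intros f) auto
  then show ?thesis
    using zero by (simp add: integrable_bounded_borel f gauss.prob_space[simplified])
qed

text \<open>The Gauss measure has density at least \<open>1/2\<close>.\<close>

lemma gauss_measure_interval_pos:
  "1 / 8 \<le> (\<integral>x. (indicator {3/4..<1} x :: real) \<partial>gauss_measure)"
proof -
  have le: "ennreal (1 / 2) * indicator {3/4..<1} x
      \<le> ennreal (1 / ((x + 1) * ln 2)) * ennreal (indicator {3/4..<1} x) * indicator {0..<1} x" for x :: real
  proof (cases "x \<in> {3/4..<1}")
    case True
    have "ln 2 \<le> (1 :: real)" using ln_le_minus_one[of "2::real"] by simp
    then have "(x + 1) * ln 2 \<le> 2 * 1" using True by (intro mult_mono) auto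
    then have "1 / 2 \<le> 1 / ((x + 1) * ln 2)" using True by (intro divide_left_mono) auto
    then have "ennreal (1 / 2) \<le> ennreal (1 / ((x + 1) * ln 2))" by (rule ennreal_leI)
    moreover have "x \<in> {0..<1}" using True by auto
    ultimately show ?thesis using True by (simp only: indicator_simps ennreal_1 mult_1_right)
  qed simp
  have "ennreal (1 / 8) = ennreal (1 / 2) * emeasure lborel {3/4..<1::real}"
    by (subst emeasure_lborel_Ico) (simp_all only: ennreal_mult'[symmetric], auto)
  also have "\<dots> = (\<integral>\<^sup>+x. ennreal (1 / 2) * indicator {3/4..<1::real} x \<partial>lborel)"
    by (rule nn_integral_cmult_indicator[symmetric]) simp
  also have "\<dots> \<le> (\<integral>\<^sup>+x. ennreal (1 / ((x + 1) * ln 2)) * ennreal (indicator {3/4..<1} x) * indicator {0..<1} x \<partial>lborel)"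
    by (intro nn_integral_mono le)
  also have "\<dots> = (\<integral>\<^sup>+x. ennreal (indicator {3/4..<1} x) \<partial>gauss_measure)"
    by (intro nn_integral_gauss_measure[symmetric]) simp
  also have "\<dots> = ennreal (\<integral>x. indicator {3/4..<1} x \<partial>gauss_measure)"
    by (intro nn_integral_eq_integral integrable_bounded_borel bounded_borel_indicator) auto
  finally show ?thesis
    by (subst (asm) ennreal_le_iff) (auto intro!: integral_nonneg_AE)
qed

text \<open>The thresholds are indexed from \<open>1\<close>, as the digits are.\<close>

locale digit_thresholds =
  fixes b :: "nat \<Rightarrow> nat"
  assumes b_pos: "\<And>n. n \<ge> 1 \<Longrightarrow> b n > 0"
begin

text \<open>The probability that the \<open>n\<close>-th digit exceeds its threshold; by invariance of the Gauss
  measure it is that of the same event for the first digit.\<close>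

definition prb :: "nat \<Rightarrow> real" where
  "prb n = (\<integral>x. indicator (large_digit (b n)) x \<partial>gauss_measure)"

text \<open>Sums start at \<open>0\<close> in the definitions below: the summand \<open>k\<close> belongs to the digit
  \<open>Suc k\<close>, which is the first digit of the \<open>k\<close>-th image point.\<close>

definition count :: "nat \<Rightarrow> real \<Rightarrow> real" where
  "count n x = (\<Sum>k<n. indicator (large_digit (b (Suc k))) ((gauss_map ^^ k) x))"

definition centred :: "nat \<Rightarrow> real \<Rightarrow> real" where
  "centred n x = (\<Sum>k<n. indicator (large_digit (b (Suc k))) ((gauss_map ^^ k) x) - prb (Suc k))"

text \<open>The conditional expectation of the centred count given the \<open>n\<close>-th image point, as a
  function of that point.\<close>

primrec cond_centred :: "nat \<Rightarrow> real \<Rightarrow> real" where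
  "cond_centred 0 = (\<lambda>_. 0)"
| "cond_centred (Suc n) = (\<lambda>x. gauss_transfer (cond_centred n) x
     + gauss_tail_transfer (b (Suc n)) (\<lambda>_. 1) x - prb (Suc n))"

text \<open>The covariance of the centred count before time \<open>n\<close> with the exceedance at time \<open>n\<close>.\<close>

definition corr :: "nat \<Rightarrow> real" where
  "corr n = (\<integral>x. indicator (large_digit (b n)) x * cond_centred (n - 1) x \<partial>gauss_measure)"

text \<open>The increment of the variance of the count at time \<open>n\<close>.\<close>

definition var_incr :: "nat \<Rightarrow> real" where
  "var_incr n = prb n - (prb n)\<^sup>2 + 2 * corr n"

lemma exceedance_count_eq:
  assumes "x \<in> {0..<1}"
  shows "exceedance_count b n x = count n x"
proof -
  have "(indicator {x. cf_digit (Suc k) x > int (b (Suc k))} x :: real)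
      = indicator (large_digit (b (Suc k))) ((gauss_map ^^ k) x)" for k
    using floor_inverse_gt_iff[OF funpow_gauss_map_mem[OF assms]]
    by (simp add: cf_digit_def indicator_def)
  moreover have "exceedance_count b n x = (\<Sum>k<n. indicator {x. cf_digit (Suc k) x > int (b (Suc k))} x)"
    unfolding exceedance_count_def
    by (rule sum.reindex_bij_witness[of _ Suc "\<lambda>k. k - 1"]) auto
  ultimately show ?thesis by (simp add: count_def)
qed

lemma centred_eq: "centred n x = count n x - (\<Sum>k<n. prb (Suc k))"
  by (simp add: centred_def count_def sum_subtractf)

lemma bounded_borel_large_digit [bounded_borel_intros]:
  "bounded_borel (indicator (large_digit k) :: real \<Rightarrow> real)"
  by (intro bounded_borel_indicator sets_large_digit)

lemmas bounded_borel_large_digit_gauss_map [bounded_borel_intros] =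
  bounded_borel_funpow_gauss_map[OF bounded_borel_large_digit]

lemma bounded_borel_count [bounded_borel_intros]: "bounded_borel (count n)"
  unfolding count_def by (intro bounded_borel_intros)

lemma bounded_borel_centred [bounded_borel_intros]: "bounded_borel (centred n)"
  unfolding centred_def by (intro bounded_borel_intros)

lemma bounded_borel_cond_centred [bounded_borel_intros]: "bounded_borel (cond_centred n)"
  by (induction n) (auto intro!: bounded_borel_intros)

lemma integral_large_digit_eq_prb [simp]:
  "(\<integral>x. indicator (large_digit (b n)) x \<partial>gauss_measure) = prb n"
  by (simp add: prb_def)

lemma prob_large_digit_eq_prb [simp]:
  "gauss.prob (large_digit (b n) \<inter> {0..<1}) = prb n"
  by (simp add: prb_def)

lemma prb_nonneg: "0 \<le> prb n"
  unfolding prb_def by (intro integral_nonneg_AE) auto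

lemma integral_indicator_mult_gauss_map:
  fixes h :: "real \<Rightarrow> real"
  assumes "bounded_borel h"
  shows "(\<integral>x. indicator (large_digit k) x * h (gauss_map x) \<partial>gauss_measure)
    = (\<integral>x. gauss_tail_transfer k (\<lambda>_. 1) x * h x \<partial>gauss_measure)"
  using integral_large_digit_mult_gauss_map[OF bounded_borel_const assms, of k 1] by simp

lemma prb_eq_integral: "prb n = (\<integral>x. (1 + x) / (real (b n) + 1 + x) \<partial>gauss_measure)"
proof -
  have "prb n = (\<integral>x. indicator (large_digit (b n)) x * 1 \<partial>gauss_measure)"
    by simp
  also have "\<dots> = (\<integral>x. gauss_tail_transfer (b n) (\<lambda>_. 1) x * 1 \<partial>gauss_measure)"
    by (intro integral_indicator_mult_gauss_map[where h = "\<lambda>_. 1"] bounded_borel_intros)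
  also have "\<dots> = (\<integral>x. (1 + x) / (real (b n) + 1 + x) \<partial>gauss_measure)"
    by (intro Bochner_Integration.integral_cong) (auto simp: gauss_tail_transfer_const)
  finally show ?thesis .
qed

lemma integral_le_const:
  fixes f :: "real \<Rightarrow> real"
  assumes "bounded_borel f" "\<And>x. x \<in> {0..<1} \<Longrightarrow> f x \<le> B"
  shows "(\<integral>x. f x \<partial>gauss_measure) \<le> B"
proof -
  have "(\<integral>x. f x \<partial>gauss_measure) \<le> (\<integral>x. B \<partial>gauss_measure)"
    by (intro integral_mono integrable_bounded_borel bounded_borel_intros assms) auto
  then show ?thesis by (simp add: gauss.prob_space[simplified])
qed

lemma prb_le_1: "prb n \<le> 1"
  unfolding prb_def by (intro integral_le_const bounded_borel_intros) (auto simp: indicator_def)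

lemma prb_le:
  assumes "n \<ge> 1"
  shows "prb n \<le> 2 * (1 / real (b n))"
proof -
  have "bounded_borel (\<lambda>x. (1 + x) / (real (b n) + 1 + x))"
    by (rule bounded_borelI[of _ 1]) (auto simp: field_simps)
  then show ?thesis
    unfolding prb_eq_integral
  proof (rule integral_le_const)
    fix x :: real assume "x \<in> {0..<1}"
    then have "(1 + x) / (real (b n) + 1 + x) \<le> 2 / real (b n)"
      using b_pos[OF assms] by (intro frac_le) auto
    then show "(1 + x) / (real (b n) + 1 + x) \<le> 2 * (1 / real (b n))" by simp
  qed
qed

lemma integral_cond_centred_Suc_mult:
  assumes h: "bounded_borel h"
  shows "(\<integral>x. (cond_centred n x + indicator (large_digit (b (Suc n))) x - prb (Suc n)) * h (gauss_map x) \<partial>gauss_measure)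
    = (\<integral>x. cond_centred (Suc n) x * h x \<partial>gauss_measure)"
proof -
  note intros = integrable_bounded_borel bounded_borel_intros h bounded_borel_gauss_map[OF h]
  have "(\<integral>x. (cond_centred n x + indicator (large_digit (b (Suc n))) x - prb (Suc n)) * h (gauss_map x) \<partial>gauss_measure)
      = (\<integral>x. cond_centred n x * h (gauss_map x) + indicator (large_digit (b (Suc n))) x * h (gauss_map x)
          - prb (Suc n) * h (gauss_map x) \<partial>gauss_measure)"
    by (intro Bochner_Integration.integral_cong refl) (simp add: algebra_simps)
  also have "\<dots> = (\<integral>x. cond_centred n x * h (gauss_map x) \<partial>gauss_measure)
      + (\<integral>x. indicator (large_digit (b (Suc n))) x * h (gauss_map x) \<partial>gauss_measure)
      - prb (Suc n) * (\<integral>x. h (gauss_map x) \<partial>gauss_measure)"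
    by (simp add: intros)
  also have "\<dots> = (\<integral>x. gauss_transfer (cond_centred n) x * h x \<partial>gauss_measure)
      + (\<integral>x. gauss_tail_transfer (b (Suc n)) (\<lambda>_. 1) x * h x \<partial>gauss_measure)
      - prb (Suc n) * (\<integral>x. h x \<partial>gauss_measure)"
    by (simp only: integral_mult_gauss_map[OF bounded_borel_cond_centred h]
        integral_indicator_mult_gauss_map[OF h] integral_gauss_map[OF h])
  also have "\<dots> = (\<integral>x. cond_centred (Suc n) x * h x \<partial>gauss_measure)"
    by (simp add: intros left_diff_distrib distrib_right)
  finally show ?thesis .
qed

text \<open>This is the property that characterises \<^const>\<open>cond_centred\<close> as a conditional expectation.\<close>

lemma integral_centred_mult:
  assumes "bounded_borel h"
  shows "(\<integral>x. centred n x * h ((gauss_map ^^ n) x) \<partial>gauss_measure) = (\<integral>x. cond_centred n x * h x \<partial>gauss_measure)"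
  using assms
proof (induction n arbitrary: h)
  case 0
  then show ?case by (simp add: centred_def)
next
  case (Suc n)
  let ?I = "\<lambda>x. indicator (large_digit (b (Suc n))) x :: real"
  note h = Suc.prems bounded_borel_gauss_map[OF Suc.prems]
  note intros = integrable_bounded_borel bounded_borel_intros h bounded_borel_funpow_gauss_map[OF h(2)]
  have "(\<integral>x. centred (Suc n) x * h ((gauss_map ^^ Suc n) x) \<partial>gauss_measure)
      = (\<integral>x. centred n x * h (gauss_map ((gauss_map ^^ n) x))
          + (?I ((gauss_map ^^ n) x) - prb (Suc n)) * h (gauss_map ((gauss_map ^^ n) x)) \<partial>gauss_measure)"
    by (intro Bochner_Integration.integral_cong refl) (simp add: centred_def algebra_simps)
  also have "\<dots> = (\<integral>x. centred n x * h (gauss_map ((gauss_map ^^ n) x)) \<partial>gauss_measure)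
      + (\<integral>x. (?I ((gauss_map ^^ n) x) - prb (Suc n)) * h (gauss_map ((gauss_map ^^ n) x)) \<partial>gauss_measure)"
    by (intro Bochner_Integration.integral_add intros)
  also have "\<dots> = (\<integral>x. cond_centred n x * h (gauss_map x) \<partial>gauss_measure)
      + (\<integral>x. (?I x - prb (Suc n)) * h (gauss_map x) \<partial>gauss_measure)"
    using Suc.IH[of "\<lambda>x. h (gauss_map x)"]
      integral_funpow_gauss_map[of "\<lambda>x. (?I x - prb (Suc n)) * h (gauss_map x)" n]
    by (simp add: intros)
  also have "\<dots> = (\<integral>x. cond_centred n x * h (gauss_map x) + (?I x - prb (Suc n)) * h (gauss_map x) \<partial>gauss_measure)"
    by (intro Bochner_Integration.integral_add[symmetric] intros)
  also have "\<dots> = (\<integral>x. (cond_centred n x + ?I x - prb (Suc n)) * h (gauss_map x) \<partial>gauss_measure)"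
    by (intro Bochner_Integration.integral_cong refl) (simp add: algebra_simps)
  finally show ?case by (simp only: integral_cond_centred_Suc_mult[OF Suc.prems])
qed

lemma integral_cond_centred [simp]: "(\<integral>x. cond_centred n x \<partial>gauss_measure) = 0"
proof (induction n)
  case (Suc n)
  have "(\<integral>x. cond_centred (Suc n) x * 1 \<partial>gauss_measure)
      = (\<integral>x. (cond_centred n x + indicator (large_digit (b (Suc n))) x - prb (Suc n)) * 1 \<partial>gauss_measure)"
    by (intro integral_cond_centred_Suc_mult[symmetric] bounded_borel_intros)
  also have "\<dots> = (\<integral>x. cond_centred n x \<partial>gauss_measure)
      + (\<integral>x. indicator (large_digit (b (Suc n))) x \<partial>gauss_measure) - prb (Suc n)"
    by (simp add: integrable_bounded_borel bounded_borel_intros gauss.prob_space[simplified])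
  finally show ?case using Suc by simp
qed simp

text \<open>The constant \<open>3 / 2\<close> is the fixed point of \<open>L \<mapsto> 5 / 6 * L + 1 / 4\<close>. That it is
  small enough is what the lower bound for the variance rests on.\<close>

lemma lipschitz_cond_centred: "(3 / 2)-lipschitz_on {0..1} (cond_centred n)"
proof (induction n)
  case 0
  show ?case by (simp add: lipschitz_on_def)
next
  case (Suc n)
  have "(5 / 6 * (3 / 2) + 1 / 4 + 0)-lipschitz_on {0..1} (cond_centred (Suc n))"
    unfolding cond_centred.simps using b_pos[of "Suc n"]
    by (intro lipschitz_on_diff lipschitz_on_add lipschitz_gauss_transfer
        lipschitz_gauss_tail_transfer_one lipschitz_on_constant Suc) auto
  then show ?case by simp
qed

lemma abs_cond_centred_le: "x \<in> {0..1} \<Longrightarrow> \<bar>cond_centred n x\<bar> \<le> 3 / 2"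
  using norm_le_lipschitz_mean_zero[OF lipschitz_cond_centred bounded_borel_cond_centred]
  by simp

lemma abs_corr_le: "\<bar>corr n\<bar> \<le> 3 / 2 * prb n"
proof -
  have "norm (corr n) \<le> (\<integral>x. 3 / 2 * indicator (large_digit (b n)) x \<partial>gauss_measure)"
    unfolding corr_def using abs_cond_centred_le
    by (intro Bochner_Integration.integral_norm_bound_integral integrable_bounded_borel bounded_borel_intros)
       (auto simp: indicator_def)
  then show ?thesis by simp
qed

lemma abs_var_incr_le: "\<bar>var_incr n\<bar> \<le> 4 * prb n"
proof -
  have "(prb n)\<^sup>2 \<le> prb n" "0 \<le> (prb n)\<^sup>2"
    using prb_nonneg[of n] prb_le_1[of n] by (auto simp: power2_eq_square mult_left_le)
  then show ?thesis
    using abs_corr_le[of n] prb_nonneg[of n] unfolding var_incr_def by linarith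
qed

lemma integral_centred_square:
  "(\<integral>x. (centred n x)\<^sup>2 \<partial>gauss_measure) = (\<Sum>k<n. var_incr (Suc k))"
proof (induction n)
  case 0
  show ?case by (simp add: centred_def)
next
  case (Suc n)
  let ?f = "\<lambda>x. indicator (large_digit (b (Suc n))) x - prb (Suc n) :: real"
  note intros = integrable_bounded_borel bounded_borel_intros
  have "(\<integral>x. (centred (Suc n) x)\<^sup>2 \<partial>gauss_measure)
      = (\<integral>x. (centred n x)\<^sup>2 + (2 * (centred n x * ?f ((gauss_map ^^ n) x)) + (?f ((gauss_map ^^ n) x))\<^sup>2) \<partial>gauss_measure)"
    by (intro Bochner_Integration.integral_cong refl) (simp add: centred_def power2_eq_square algebra_simps)
  also have "\<dots> = (\<integral>x. (centred n x)\<^sup>2 \<partial>gauss_measure)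
      + (2 * (\<integral>x. centred n x * ?f ((gauss_map ^^ n) x) \<partial>gauss_measure) + (\<integral>x. (?f ((gauss_map ^^ n) x))\<^sup>2 \<partial>gauss_measure))"
  proof -
    have "(\<integral>x. 2 * (centred n x * ?f ((gauss_map ^^ n) x)) \<partial>gauss_measure)
        = 2 * (\<integral>x. centred n x * ?f ((gauss_map ^^ n) x) \<partial>gauss_measure)"
      by simp
    then show ?thesis
      by (simp add: intros)
  qed
  also have "(\<integral>x. centred n x * ?f ((gauss_map ^^ n) x) \<partial>gauss_measure) = (\<integral>x. cond_centred n x * ?f x \<partial>gauss_measure)"
    by (intro integral_centred_mult bounded_borel_intros)
  also have "\<dots> = corr (Suc n)"
  proof -
    have "(\<integral>x. cond_centred n x * ?f x \<partial>gauss_measure)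
        = (\<integral>x. indicator (large_digit (b (Suc n))) x * cond_centred n x - prb (Suc n) * cond_centred n x \<partial>gauss_measure)"
      by (intro Bochner_Integration.integral_cong refl) (simp add: algebra_simps)
    also have "\<dots> = corr (Suc n) - prb (Suc n) * (\<integral>x. cond_centred n x \<partial>gauss_measure)"
      unfolding corr_def by (simp add: intros)
    finally show ?thesis by simp
  qed
  also have "(\<integral>x. (?f ((gauss_map ^^ n) x))\<^sup>2 \<partial>gauss_measure) = (\<integral>x. (?f x)\<^sup>2 \<partial>gauss_measure)"
    by (intro integral_funpow_gauss_map[where h = "\<lambda>x. (?f x)\<^sup>2"] bounded_borel_intros)
  also have "\<dots> = prb (Suc n) - (prb (Suc n))\<^sup>2"
  proof -
    have "(?f x)\<^sup>2 = (1 - 2 * prb (Suc n)) * indicator (large_digit (b (Suc n))) x + (prb (Suc n))\<^sup>2" for x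
      by (simp add: indicator_def power2_eq_square algebra_simps)
    then have "(\<integral>x. (?f x)\<^sup>2 \<partial>gauss_measure) = (1 - 2 * prb (Suc n)) * prb (Suc n) + (prb (Suc n))\<^sup>2"
      by (simp add: intros gauss.prob_space[simplified])
    then show ?thesis by (simp add: power2_eq_square algebra_simps)
  qed
  finally show ?case using Suc by (simp add: var_incr_def)
qed

lemma integral_count: "(\<integral>x. count n x \<partial>gauss_measure) = (\<Sum>k<n. prb (Suc k))"
  unfolding count_def
  by (subst Bochner_Integration.integral_sum)
     (auto intro!: integrable_bounded_borel bounded_borel_intros
       simp: integral_funpow_gauss_map bounded_borel_intros)

lemma expectation_exceedance_count:
  "gauss.expectation (exceedance_count b n) = (\<Sum>k<n. prb (Suc k))"
  unfolding integral_count[symmetric]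
  by (intro Bochner_Integration.integral_cong) (auto simp: exceedance_count_eq)

lemma variance_exceedance_count:
  "gauss.variance (exceedance_count b n) = (\<Sum>k<n. var_incr (Suc k))"
  unfolding integral_centred_square[symmetric] expectation_exceedance_count
  by (intro Bochner_Integration.integral_cong) (auto simp: exceedance_count_eq centred_eq)

text \<open>The centred count is the sum of reverse martingale differences and of a bounded term. All
  inverse images of a point of \<open>{3/4..<1}\<close> lie in \<open>{0..4/7}\<close>, where the conditional
  expectation stays within \<open>3/7\<close> of its value at the midpoint \<open>2/7\<close>. It therefore cannot
  compensate the unit jump of the indicator: given the image point, the difference has absolute
  value at least \<open>1/2 - 3/7\<close> on the large digits or on the other ones, according to the side
  of the middle value \<open>mid\<close> on which the image point sends the new conditional expectation.\<close>

lemma martingale_difference_lower_bound: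
  "1 / 4704 * (1 / real (b (Suc n)))
    \<le> (\<integral>x. (cond_centred n x + indicator (large_digit (b (Suc n))) x - prb (Suc n)
              - cond_centred (Suc n) (gauss_map x))\<^sup>2 \<partial>gauss_measure)"
proof -
  let ?A = "large_digit (b (Suc n))"
  define d where "d x = cond_centred n x + indicator ?A x - prb (Suc n) - cond_centred (Suc n) (gauss_map x)" for x
  define mid where "mid = cond_centred n (2 / 7) - prb (Suc n) + 1 / 2"
  define U where "U = {3/4..<1} \<inter> {x. cond_centred (Suc n) x \<le> mid}"
  define W where "W = {3/4..<1} \<inter> {x. mid < cond_centred (Suc n) x}"
  have [measurable]: "cond_centred (Suc n) \<in> borel_measurable borel"
    using bounded_borel_cond_centred by (rule bounded_borel_measurable)
  have [measurable]: "U \<in> sets borel" "W \<in> sets borel" unfolding U_def W_def by measurable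
  note intros = integrable_bounded_borel bounded_borel_intros \<open>U \<in> sets borel\<close> \<open>W \<in> sets borel\<close>
  have point: "1 / 196 * (indicator ?A x * indicator U (gauss_map x) + (1 - indicator ?A x) * indicator W (gauss_map x))
      \<le> (d x)\<^sup>2" if x: "x \<in> {0..<1}" for x
  proof (cases "gauss_map x \<in> {3/4..<1}")
    case True
    then have "x \<noteq> 0" by (auto simp: gauss_map_def)
    with x have "x > 0" by simp
    have "1 / x \<ge> 1" using x \<open>x > 0\<close> by (simp add: field_simps)
    then have "of_int \<lfloor>1 / x\<rfloor> \<ge> (1 :: real)" by simp
    moreover have "3 / 4 \<le> 1 / x - of_int \<lfloor>1 / x\<rfloor>"
      using True \<open>x \<noteq> 0\<close> by (simp add: gauss_map_def)
    ultimately have "1 / x \<ge> 7 / 4" by linarith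
    then have "x \<le> 4 / 7" using \<open>x > 0\<close> by (simp add: field_simps)
    have lip: "\<bar>cond_centred n x - cond_centred n (2 / 7)\<bar> \<le> 3 / 2 * \<bar>x - 2 / 7\<bar>"
      using lipschitz_on_normD[OF lipschitz_cond_centred, of x "2 / 7" n] x by simp
    have "\<bar>x - 2 / 7\<bar> \<le> 2 / 7"
      using \<open>x > 0\<close> \<open>x \<le> 4 / 7\<close> unfolding abs_le_iff by linarith
    then have "3 / 2 * \<bar>x - 2 / 7\<bar> \<le> 3 / 2 * (2 / 7)" by (rule mult_left_mono) simp
    from order_trans[OF lip this]
    have near: "\<bar>cond_centred n x - cond_centred n (2 / 7)\<bar> \<le> 3 / 7" by simp
    have square: "1 / 196 \<le> (d x)\<^sup>2" if "\<bar>d x\<bar> \<ge> 1 / 14"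
      using power_mono[OF that, of 2] by (simp add: power2_eq_square)
    from near have lo: "cond_centred n (2 / 7) - 3 / 7 \<le> cond_centred n x"
      and hi: "cond_centred n x \<le> cond_centred n (2 / 7) + 3 / 7"
      unfolding abs_le_iff by linarith+
    have "\<bar>d x\<bar> \<ge> 1 / 14" if "x \<in> ?A" "gauss_map x \<in> U"
    proof -
      have "cond_centred (Suc n) (gauss_map x) \<le> mid" using that(2) by (simp only: U_def Int_iff mem_Collect_eq)
      moreover have "d x = cond_centred n x + 1 - prb (Suc n) - cond_centred (Suc n) (gauss_map x)"
        unfolding d_def using that(1) by (simp only: indicator_simps)
      ultimately have "1 / 14 \<le> d x" using lo unfolding mid_def by linarith
      then show ?thesis by linarith
    qed
    moreover have "\<bar>d x\<bar> \<ge> 1 / 14" if "x \<notin> ?A" "gauss_map x \<in> W"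
    proof -
      have "mid < cond_centred (Suc n) (gauss_map x)" using that(2) by (simp only: W_def Int_iff mem_Collect_eq)
      moreover have "d x = cond_centred n x + 0 - prb (Suc n) - cond_centred (Suc n) (gauss_map x)"
        unfolding d_def using that(1) by (simp del: cond_centred.simps)
      ultimately have "1 / 14 \<le> - d x" using hi unfolding mid_def by linarith
      then show ?thesis by linarith
    qed
    ultimately show ?thesis
      using square by (auto simp: indicator_def)
  qed (auto simp: U_def W_def)
  have bn: "real (b (Suc n)) \<ge> 1" using b_pos[of "Suc n"] by simp
  define \<pi>n where "\<pi>n x = gauss_tail_transfer (b (Suc n)) (\<lambda>_. 1 :: real) x" for x
  have \<pi>n_bound: "bounded_borel \<pi>n" unfolding \<pi>n_def by (intro bounded_borel_intros)
  \<comment> \<open>Here \<open>196\<close> is the square of \<open>14\<close>, the factor \<open>3\<close> comes from the lower bound for the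
      conditional probabilities of the large digits and of the other ones, and \<open>8\<close> from the
      lower bound for the measure of \<open>{3/4..<1}\<close>.\<close>
  have "1 / 4704 * (1 / real (b (Suc n))) = 1 / 196 * (1 / (3 * real (b (Suc n))) * (1 / 8))"
    by simp
  also have "\<dots> \<le> 1 / 196 * (1 / (3 * real (b (Suc n))) * (\<integral>x. indicator {3/4..<1} x \<partial>gauss_measure))"
    by (intro mult_left_mono gauss_measure_interval_pos) auto
  also have "1 / (3 * real (b (Suc n))) * (\<integral>x. indicator {3/4..<1} x \<partial>gauss_measure)
      = (\<integral>x. 1 / (3 * real (b (Suc n))) * indicator {3/4..<1} x \<partial>gauss_measure)"
    by simp
  also have "1 / 196 * \<dots> \<le> 1 / 196 * (\<integral>x. \<pi>n x * indicator U x + (indicator W x - \<pi>n x * indicator W x) \<partial>gauss_measure)"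
  proof (intro mult_left_mono integral_mono intros \<pi>n_bound)
    fix x assume "x \<in> space gauss_measure"
    then have x: "x \<in> {0..<1}" by simp
    then have eq: "\<pi>n x = (1 + x) / (real (b (Suc n)) + 1 + x)"
      by (simp add: \<pi>n_def gauss_tail_transfer_const)
    have lower: "1 / (3 * real (b (Suc n))) \<le> \<pi>n x"
      unfolding eq using x bn by (intro frac_le) auto
    have "1 / (3 * real (b (Suc n))) \<le> 1 / 3" using bn by (simp add: field_simps)
    moreover have "1 / 3 \<le> 1 - \<pi>n x"
      unfolding eq using x bn by (simp add: field_simps)
    ultimately have upper: "1 / (3 * real (b (Suc n))) \<le> 1 - \<pi>n x" by (rule order_trans)
    consider "x \<notin> {3/4..<1}" "x \<notin> U" "x \<notin> W" | "x \<in> {3/4..<1}" "x \<in> U" "x \<notin> W"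
      | "x \<in> {3/4..<1}" "x \<notin> U" "x \<in> W"
      unfolding U_def W_def by (auto simp del: cond_centred.simps)
    then show "1 / (3 * real (b (Suc n))) * indicator {3/4..<1} x
        \<le> \<pi>n x * indicator U x + (indicator W x - \<pi>n x * indicator W x)"
      using lower upper by cases (simp_all only: indicator_simps not_False_eq_True mult_1_right mult_zero_right diff_zero add_0_left add_0_right order_refl diff_self)
  qed auto
  also have "(\<integral>x. \<pi>n x * indicator U x + (indicator W x - \<pi>n x * indicator W x) \<partial>gauss_measure)
      = (\<integral>x. \<pi>n x * indicator U x \<partial>gauss_measure)
        + ((\<integral>x. indicator W x \<partial>gauss_measure) - (\<integral>x. \<pi>n x * indicator W x \<partial>gauss_measure))"
    by (simp add: intros \<pi>n_bound)
  also have "\<dots> = (\<integral>x. indicator ?A x * indicator U (gauss_map x) \<partial>gauss_measure)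
        + ((\<integral>x. indicator W (gauss_map x) \<partial>gauss_measure)
           - (\<integral>x. indicator ?A x * indicator W (gauss_map x) \<partial>gauss_measure))"
    unfolding \<pi>n_def
    by (simp only: integral_indicator_mult_gauss_map[OF bounded_borel_indicator]
        integral_gauss_map[OF bounded_borel_indicator] \<open>U \<in> sets borel\<close> \<open>W \<in> sets borel\<close>)
  also have "\<dots> = (\<integral>x. indicator ?A x * indicator U (gauss_map x)
      + (indicator W (gauss_map x) - indicator ?A x * indicator W (gauss_map x)) \<partial>gauss_measure)"
    by (simp add: intros)
  also have "1 / 196 * \<dots> = (\<integral>x. 1 / 196 * (indicator ?A x * indicator U (gauss_map x)
      + (indicator W (gauss_map x) - indicator ?A x * indicator W (gauss_map x))) \<partial>gauss_measure)"
    by (rule Bochner_Integration.integral_mult_right_zero[symmetric])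
  also have "\<dots> \<le> (\<integral>x. (d x)\<^sup>2 \<partial>gauss_measure)"
  proof (rule integral_mono)
    show "integrable gauss_measure (\<lambda>x. (d x)\<^sup>2)"
      unfolding d_def by (intro intros bounded_borel_gauss_map[OF bounded_borel_cond_centred])
    show "integrable gauss_measure (\<lambda>x. (1 / 196 :: real) * (indicator ?A x * indicator U (gauss_map x)
      + (indicator W (gauss_map x) - indicator ?A x * indicator W (gauss_map x))))"
      by (intro intros)
    show "1 / 196 * (indicator ?A x * indicator U (gauss_map x)
      + (indicator W (gauss_map x) - indicator ?A x * indicator W (gauss_map x))) \<le> (d x)\<^sup>2"
      if "x \<in> space gauss_measure" for x
      using point[of x] that by (simp add: algebra_simps)
  qed
  finally show ?thesis by (simp only: d_def)
qed

text \<open>Summed over \<open>n\<close>, the second moments of the conditional expectations telescope.\<close>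

lemma var_incr_lower_bound:
  "(\<integral>x. (cond_centred (Suc n) x)\<^sup>2 \<partial>gauss_measure) + 1 / 4704 * (1 / real (b (Suc n)))
    \<le> (\<integral>x. (cond_centred n x)\<^sup>2 \<partial>gauss_measure) + var_incr (Suc n)"
proof -
  let ?I = "\<lambda>x. indicator (large_digit (b (Suc n))) x :: real"
  let ?p = "prb (Suc n)"
  define F where "F x = cond_centred n x + ?I x - ?p" for x
  define e where "e = cond_centred (Suc n)"
  have F: "bounded_borel F" and e: "bounded_borel e"
    unfolding F_def e_def by (intro bounded_borel_intros)+
  note intros = integrable_bounded_borel bounded_borel_intros F e bounded_borel_gauss_map[OF e]
  have "1 / 4704 * (1 / real (b (Suc n))) \<le> (\<integral>x. (F x - e (gauss_map x))\<^sup>2 \<partial>gauss_measure)"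
    unfolding F_def e_def by (rule martingale_difference_lower_bound)
  also have "\<dots> = (\<integral>x. (F x)\<^sup>2 + ((e (gauss_map x))\<^sup>2 - 2 * (F x * e (gauss_map x))) \<partial>gauss_measure)"
    by (intro Bochner_Integration.integral_cong refl) (simp add: power2_eq_square algebra_simps)
  also have "\<dots> = (\<integral>x. (F x)\<^sup>2 \<partial>gauss_measure) + ((\<integral>x. (e (gauss_map x))\<^sup>2 \<partial>gauss_measure)
      - 2 * (\<integral>x. F x * e (gauss_map x) \<partial>gauss_measure))"
    by (simp add: intros)
  also have "(\<integral>x. (e (gauss_map x))\<^sup>2 \<partial>gauss_measure) = (\<integral>x. (e x)\<^sup>2 \<partial>gauss_measure)"
    by (intro integral_gauss_map[where h = "\<lambda>x. (e x)\<^sup>2"] intros)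
  also have "(\<integral>x. F x * e (gauss_map x) \<partial>gauss_measure) = (\<integral>x. (e x)\<^sup>2 \<partial>gauss_measure)"
    using integral_cond_centred_Suc_mult[OF e, of n] by (simp only: F_def e_def power2_eq_square)
  also have "(\<integral>x. (F x)\<^sup>2 \<partial>gauss_measure) = (\<integral>x. (cond_centred n x)\<^sup>2 \<partial>gauss_measure) + var_incr (Suc n)"
  proof -
    have "(F x)\<^sup>2 = (cond_centred n x)\<^sup>2 + (2 * (?I x * cond_centred n x)
        + ((- 2 * ?p) * cond_centred n x + ((1 - 2 * ?p) * ?I x + ?p\<^sup>2)))" for x
      by (simp add: F_def indicator_def power2_eq_square algebra_simps)
    then have "(\<integral>x. (F x)\<^sup>2 \<partial>gauss_measure) = (\<integral>x. (cond_centred n x)\<^sup>2 + (2 * (?I x * cond_centred n x)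
        + ((- 2 * ?p) * cond_centred n x + ((1 - 2 * ?p) * ?I x + ?p\<^sup>2))) \<partial>gauss_measure)"
      by simp
    also have "\<dots> = (\<integral>x. (cond_centred n x)\<^sup>2 \<partial>gauss_measure) + (2 * corr (Suc n)
        + ((- 2 * ?p) * (\<integral>x. cond_centred n x \<partial>gauss_measure) + ((1 - 2 * ?p) * ?p + ?p\<^sup>2)))"
      unfolding corr_def prb_def
      by (simp add: intros gauss.prob_space[simplified])
    finally show ?thesis
      by (simp add: var_incr_def power2_eq_square algebra_simps)
  qed
  finally show ?thesis by (simp add: e_def)
qed

lemma variance_lower_bound:
  "1 / 4704 * (\<Sum>k<n. 1 / real (b (Suc k))) \<le> (\<Sum>k<n. var_incr (Suc k))"
proof -
  have "(\<integral>x. (cond_centred n x)\<^sup>2 \<partial>gauss_measure) + 1 / 4704 * (\<Sum>k<n. 1 / real (b (Suc k)))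
      \<le> (\<Sum>k<n. var_incr (Suc k))"
  proof (induction n)
    case (Suc n)
    then show ?case using var_incr_lower_bound[of n] by (simp add: algebra_simps)
  qed simp
  moreover have "0 \<le> (\<integral>x. (cond_centred n x)\<^sup>2 \<partial>gauss_measure)"
    by (intro integral_nonneg_AE) auto
  ultimately show ?thesis by linarith
qed

end

section \<open>Characteristic functions\<close>

lemma norm_cis_minus_one_le: "cmod (cis t - 1) \<le> \<bar>t\<bar>"
  using iexp_approx1[of t 0] by (simp add: cis_conv_exp)

text \<open>One step of the recursion for the characteristic function agrees to second order with
  multiplication by an exponential.\<close>

lemma exp_quadratic_step:
  fixes p e t :: real
  assumes p: "0 \<le> p" "p \<le> 1" and e: "\<bar>e\<bar> \<le> 3 / 2 * p" and t: "\<bar>t\<bar> \<le> 1 / 24"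
  shows "cmod (1 + (cis t - 1) * p + (cis t - 1)\<^sup>2 * e
      - exp (\<i> * t * p - complex_of_real (t\<^sup>2 * (p - p\<^sup>2 + 2 * e) / 2))) \<le> 50 * \<bar>t\<bar> ^ 3 * p"
proof -
  define v where "v = p - p\<^sup>2 + 2 * e"
  define T where "T = \<i> * complex_of_real t"
  define \<zeta> where "\<zeta> = cis t - 1"
  define w where "w = T * p + T\<^sup>2 * v / 2"
  define \<rho> where "\<rho> = \<zeta> - T - T\<^sup>2 / 2"
  define \<rho>' where "\<rho>' = exp w - (1 + w + w\<^sup>2 / 2)"
  have T_norm: "cmod T = \<bar>t\<bar>" by (simp add: T_def norm_mult)
  have t2: "\<bar>t\<bar> * \<bar>t\<bar> \<le> 1 / 24 * \<bar>t\<bar>" using t by (intro mult_right_mono) auto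
  have p2: "p\<^sup>2 \<le> p" "0 \<le> p\<^sup>2" using p by (auto simp: power2_eq_square mult_left_le)
  have v: "\<bar>v\<bar> \<le> 4 * p" unfolding v_def using p2 e p by linarith
  have w_eq: "\<i> * t * p - complex_of_real (t\<^sup>2 * (p - p\<^sup>2 + 2 * e) / 2) = w"
    by (simp add: w_def T_def v_def power_mult_distrib)
  have \<rho>: "cmod \<rho> \<le> \<bar>t\<bar> ^ 3 / 6"
    using iexp_approx1[of t 2]
    by (simp add: \<rho>_def \<zeta>_def T_def cis_conv_exp numeral_eq_Suc power_mult_distrib algebra_simps)
  have \<zeta>: "cmod \<zeta> \<le> \<bar>t\<bar>"
    unfolding \<zeta>_def by (rule norm_cis_minus_one_le)
  have \<zeta>T: "cmod (\<zeta> - T) \<le> \<bar>t\<bar>\<^sup>2 / 2"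
    using iexp_approx1[of t 1] by (simp add: \<zeta>_def T_def cis_conv_exp numeral_eq_Suc algebra_simps)
  have sq: "cmod (\<zeta>\<^sup>2 - T\<^sup>2) \<le> \<bar>t\<bar> ^ 3"
  proof -
    have "\<zeta>\<^sup>2 - T\<^sup>2 = (\<zeta> - T) * (\<zeta> + T)" by (simp add: power2_eq_square algebra_simps)
    then have "cmod (\<zeta>\<^sup>2 - T\<^sup>2) = cmod (\<zeta> - T) * cmod (\<zeta> + T)" by (simp add: norm_mult)
    also have "\<dots> \<le> (\<bar>t\<bar>\<^sup>2 / 2) * (\<bar>t\<bar> + \<bar>t\<bar>)"
      using \<zeta> T_norm by (intro mult_mono \<zeta>T order_trans[OF norm_triangle_ineq] add_mono) auto
    finally show ?thesis by (simp add: power2_eq_square power3_eq_cube)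
  qed
  have w_norm: "cmod w \<le> 3 * \<bar>t\<bar> * p"
  proof -
    have "cmod w \<le> cmod (T * p) + cmod (T\<^sup>2 * v / 2)"
      unfolding w_def by (rule norm_triangle_ineq)
    also have "\<dots> = \<bar>t\<bar> * p + \<bar>t\<bar> * \<bar>t\<bar> * \<bar>v\<bar> / 2"
      using p by (simp add: norm_mult norm_divide norm_power T_norm power2_eq_square)
    also have "\<bar>t\<bar> * \<bar>t\<bar> * \<bar>v\<bar> \<le> (1 / 24 * \<bar>t\<bar>) * (4 * p)"
      by (intro mult_mono t2 v) auto
    finally show ?thesis using mult_nonneg_nonneg[OF p(1), of "\<bar>t\<bar>"] by (simp add: mult_ac)
  qed
  have \<rho>': "cmod \<rho>' \<le> 81 / 2 * \<bar>t\<bar> ^ 3 * p"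
  proof -
    have "\<bar>Re w\<bar> \<le> 3 * \<bar>t\<bar> * p" using w_norm abs_Re_le_cmod order_trans by blast
    also have "\<dots> \<le> 3 * (1 / 24) * 1" using t p by (intro mult_mono) auto
    finally have "exp \<bar>Re w\<bar> \<le> exp 1" by simp
    also have "\<dots> \<le> 3" by (rule exp_le)
    finally have exp3: "exp \<bar>Re w\<bar> \<le> 3" .
    have "cmod \<rho>' \<le> exp \<bar>Re w\<bar> * cmod w ^ 3 / 2"
      using Taylor_exp[of w 2] by (simp add: \<rho>'_def numeral_eq_Suc)
    also have "\<dots> \<le> 3 * (3 * \<bar>t\<bar> * p) ^ 3 / 2"
      using exp3 w_norm by (intro divide_right_mono mult_mono power_mono) auto
    also have "\<dots> = 81 / 2 * \<bar>t\<bar> ^ 3 * p ^ 3" by (simp add: power_mult_distrib)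
    also have "\<dots> \<le> 81 / 2 * \<bar>t\<bar> ^ 3 * p"
      using p power_decreasing[of 1 3 p] by (intro mult_left_mono) auto
    finally show ?thesis .
  qed
  have "1 + \<zeta> * p + \<zeta>\<^sup>2 * e - exp w
      = \<rho> * p + (\<zeta>\<^sup>2 - T\<^sup>2) * e - T ^ 3 * p * v / 2 - T ^ 4 * (complex_of_real v)\<^sup>2 / 8 - \<rho>'"
  proof -
    have T2: "T\<^sup>2 * v / 2 + T\<^sup>2 * p\<^sup>2 / 2 = T\<^sup>2 * p / 2 + T\<^sup>2 * e"
      by (simp add: v_def algebra_simps add_divide_distrib diff_divide_distrib)
    have "w\<^sup>2 / 2 = T\<^sup>2 * p\<^sup>2 / 2 + T ^ 3 * p * v / 2 + T ^ 4 * (complex_of_real v)\<^sup>2 / 8"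
      unfolding w_def by (simp add: numeral_eq_Suc algebra_simps)
    then have exp_w: "exp w = 1 + T * p + (T\<^sup>2 * v / 2 + T\<^sup>2 * p\<^sup>2 / 2) + T ^ 3 * p * v / 2
        + T ^ 4 * (complex_of_real v)\<^sup>2 / 8 + \<rho>'"
      unfolding \<rho>'_def by (simp add: w_def algebra_simps)
    have "1 + \<zeta> * p + \<zeta>\<^sup>2 * e = 1 + T * p + (T\<^sup>2 * p / 2 + T\<^sup>2 * e) + \<rho> * p + (\<zeta>\<^sup>2 - T\<^sup>2) * e"
      unfolding \<rho>_def by (simp add: algebra_simps add_divide_distrib diff_divide_distrib)
    then show ?thesis by (simp only: exp_w T2) (simp only: algebra_simps)
  qed
  also have "cmod \<dots> \<le> cmod (\<rho> * p) + cmod ((\<zeta>\<^sup>2 - T\<^sup>2) * e) + cmod (T ^ 3 * p * v / 2)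
      + cmod (T ^ 4 * (complex_of_real v)\<^sup>2 / 8) + cmod \<rho>'"
    by (intro order_trans[OF norm_triangle_ineq4] add_mono order_trans[OF norm_triangle_ineq] order_refl)
  also have "\<dots> \<le> \<bar>t\<bar> ^ 3 / 6 * p + \<bar>t\<bar> ^ 3 * (3 / 2 * p) + \<bar>t\<bar> ^ 3 * (2 * p) + \<bar>t\<bar> ^ 3 * p + 81 / 2 * \<bar>t\<bar> ^ 3 * p"
  proof (intro add_mono \<rho>')
    show "cmod (\<rho> * p) \<le> \<bar>t\<bar> ^ 3 / 6 * p"
      using mult_right_mono[OF \<rho> p(1)] p by (simp add: norm_mult)
    show "cmod ((\<zeta>\<^sup>2 - T\<^sup>2) * e) \<le> \<bar>t\<bar> ^ 3 * (3 / 2 * p)"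
      using sq e by (simp only: norm_mult norm_of_real) (intro mult_mono, auto)
    have "\<bar>t\<bar> ^ 3 * (p * \<bar>v\<bar> / 2) \<le> \<bar>t\<bar> ^ 3 * (1 * (4 * p) / 2)"
      using p v by (intro mult_left_mono divide_right_mono mult_mono) auto
    then show "cmod (T ^ 3 * p * v / 2) \<le> \<bar>t\<bar> ^ 3 * (2 * p)"
      using p by (simp add: norm_mult norm_divide norm_power T_norm mult_ac)
    have "\<bar>v\<bar>\<^sup>2 \<le> (4 * p)\<^sup>2" using v by (intro power_mono) auto
    also have "\<dots> \<le> 16 * p" using p2 by (simp add: power_mult_distrib)
    finally have "\<bar>t\<bar> ^ 3 * (\<bar>t\<bar> * \<bar>v\<bar>\<^sup>2 / 8) \<le> \<bar>t\<bar> ^ 3 * (1 / 24 * (16 * p) / 8)"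
      using t by (intro mult_left_mono divide_right_mono mult_mono) auto
    also have "\<dots> \<le> \<bar>t\<bar> ^ 3 * p" using p by (intro mult_left_mono) auto
    finally show "cmod (T ^ 4 * (complex_of_real v)\<^sup>2 / 8) \<le> \<bar>t\<bar> ^ 3 * p"
      by (simp add: norm_mult norm_divide norm_power T_norm numeral_eq_Suc mult_ac)
  qed
  also have "\<dots> \<le> 50 * \<bar>t\<bar> ^ 3 * p"
    using mult_nonneg_nonneg[of "\<bar>t\<bar> ^ 3" p] p by simp
  finally show ?thesis unfolding \<zeta>_def w_eq .
qed

lemma lipschitz_on_mult_left:
  fixes f :: "'b::metric_space \<Rightarrow> 'a::real_normed_algebra"
  assumes "L-lipschitz_on U f"
  shows "(norm a * L)-lipschitz_on U (\<lambda>x. a * f x)"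
proof (rule lipschitz_onI)
  show "0 \<le> norm a * L" using lipschitz_on_nonneg[OF assms] by simp
  fix x y assume "x \<in> U" "y \<in> U"
  have "dist (a * f x) (a * f y) \<le> norm a * dist (f x) (f y)"
    by (simp add: dist_norm right_diff_distrib[symmetric] norm_mult_ineq)
  also have "\<dots> \<le> norm a * (L * dist x y)"
    using lipschitz_onD[OF assms \<open>x \<in> U\<close> \<open>y \<in> U\<close>] by (rule mult_left_mono) simp
  finally show "dist (a * f x) (a * f y) \<le> norm a * L * dist x y" by (simp add: mult_ac)
qed

lemma lipschitz_on_of_real:
  "L-lipschitz_on U f \<Longrightarrow> L-lipschitz_on U (\<lambda>x. complex_of_real (f x))"
  by (simp add: lipschitz_on_def)

context digit_thresholds
begin

text \<open>The conditional expectation of \<open>cis (t * count n x)\<close> given the \<open>n\<close>-th image point, as a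
  function of that point.\<close>

primrec char_density :: "real \<Rightarrow> nat \<Rightarrow> real \<Rightarrow> complex" where
  "char_density t 0 = (\<lambda>_. 1)"
| "char_density t (Suc n) = (\<lambda>x. gauss_transfer (char_density t n) x
     + (cis t - 1) * gauss_tail_transfer (b (Suc n)) (char_density t n) x)"

text \<open>The characteristic function of the count.\<close>

definition char_count :: "real \<Rightarrow> nat \<Rightarrow> complex" where
  "char_count t n = (\<integral>x. char_density t n x \<partial>gauss_measure)"

text \<open>What is left of \<^const>\<open>char_density\<close> after its first-order expansion, in which
  \<^term>\<open>cis t - 1\<close> plays the role of \<open>\<i> * t\<close>.\<close>

definition char_rem :: "real \<Rightarrow> nat \<Rightarrow> real \<Rightarrow> complex" where
  "char_rem t n x = char_density t n x
     - char_count t n * (1 + (cis t - 1) * complex_of_real (cond_centred n x))"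

lemma bounded_borel_char_density [bounded_borel_intros]: "bounded_borel (char_density t n)"
  by (induction n) (auto intro!: bounded_borel_intros)

lemma bounded_borel_char_rem [bounded_borel_intros]: "bounded_borel (char_rem t n)"
  unfolding char_rem_def by (intro bounded_borel_intros)

lemma bounded_borel_cis_count [bounded_borel_intros]: "bounded_borel (\<lambda>x. cis (t * count n x))"
proof -
  have [measurable]: "count n \<in> borel_measurable borel"
    using bounded_borel_count by (rule bounded_borel_measurable)
  show ?thesis by (rule bounded_borel_cis) measurable
qed

lemma cis_count_Suc:
  "cis (t * count (Suc n) x) = cis (t * count n x)
     * (1 + (cis t - 1) * complex_of_real (indicator (large_digit (b (Suc n))) ((gauss_map ^^ n) x)))"
proof -
  have "cis (t * count (Suc n) x) = cis (t * count n x)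
      * cis (t * indicator (large_digit (b (Suc n))) ((gauss_map ^^ n) x))"
    by (simp only: count_def sum.lessThan_Suc distrib_left cis_mult)
  then show ?thesis by (cases "(gauss_map ^^ n) x \<in> large_digit (b (Suc n))") simp_all
qed

text \<open>This is the property that characterises \<^const>\<open>char_density\<close> as a conditional expectation.\<close>

lemma integral_cis_count_mult:
  assumes "bounded_borel h"
  shows "(\<integral>x. cis (t * count n x) * h ((gauss_map ^^ n) x) \<partial>gauss_measure)
    = (\<integral>x. char_density t n x * h x \<partial>gauss_measure)"
  using assms
proof (induction n arbitrary: h)
  case 0
  then show ?case by (simp add: count_def)
next
  case (Suc n)
  let ?A = "large_digit (b (Suc n))" and ?\<zeta> = "cis t - 1"
  note h = Suc.prems bounded_borel_gauss_map[OF Suc.prems]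
  note intros = integrable_bounded_borel bounded_borel_intros h
  have "(\<integral>x. cis (t * count (Suc n) x) * h ((gauss_map ^^ Suc n) x) \<partial>gauss_measure)
      = (\<integral>x. cis (t * count n x) * (\<lambda>y. (1 + ?\<zeta> * complex_of_real (indicator ?A y)) * h (gauss_map y))
          ((gauss_map ^^ n) x) \<partial>gauss_measure)"
    by (intro Bochner_Integration.integral_cong refl) (simp add: cis_count_Suc mult_ac)
  also have "\<dots> = (\<integral>x. char_density t n x * ((1 + ?\<zeta> * complex_of_real (indicator ?A x)) * h (gauss_map x)) \<partial>gauss_measure)"
    by (intro Suc.IH bounded_borel_intros h)
  also have "\<dots> = (\<integral>x. char_density t n x * h (gauss_map x)
      + ?\<zeta> * ((indicator ?A x *\<^sub>R char_density t n x) * h (gauss_map x)) \<partial>gauss_measure)"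
    by (intro Bochner_Integration.integral_cong refl) (simp add: scaleR_conv_of_real algebra_simps)
  also have "\<dots> = (\<integral>x. char_density t n x * h (gauss_map x) \<partial>gauss_measure)
      + ?\<zeta> * (\<integral>x. (indicator ?A x *\<^sub>R char_density t n x) * h (gauss_map x) \<partial>gauss_measure)"
    by (subst Bochner_Integration.integral_add) (intro intros | simp only: integral_mult_right_zero)+
  also have "\<dots> = (\<integral>x. gauss_transfer (char_density t n) x * h x \<partial>gauss_measure)
      + ?\<zeta> * (\<integral>x. gauss_tail_transfer (b (Suc n)) (char_density t n) x * h x \<partial>gauss_measure)"
    by (simp only: integral_mult_gauss_map[OF bounded_borel_char_density Suc.prems]
        integral_large_digit_mult_gauss_map[OF bounded_borel_char_density Suc.prems])
  also have "\<dots> = (\<integral>x. gauss_transfer (char_density t n) x * h x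
      + ?\<zeta> * (gauss_tail_transfer (b (Suc n)) (char_density t n) x * h x) \<partial>gauss_measure)"
    by (subst Bochner_Integration.integral_add) (intro intros | simp only: integral_mult_right_zero)+
  also have "\<dots> = (\<integral>x. char_density t (Suc n) x * h x \<partial>gauss_measure)"
    by (intro Bochner_Integration.integral_cong refl) (simp add: algebra_simps)
  finally show ?case .
qed

lemma char_count_eq: "char_count t n = (\<integral>x. cis (t * count n x) \<partial>gauss_measure)"
  using integral_cis_count_mult[of "\<lambda>_. 1" t n] by (simp add: char_count_def bounded_borel_const)

lemma norm_integral_le_const:
  fixes f :: "real \<Rightarrow> complex"
  assumes f: "bounded_borel f" and B: "\<And>x. x \<in> {0..<1} \<Longrightarrow> norm (f x) \<le> B"
  shows "norm (\<integral>x. f x \<partial>gauss_measure) \<le> B"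
proof -
  have "norm (\<integral>x. f x \<partial>gauss_measure) \<le> (\<integral>x. B \<partial>gauss_measure)"
    using B by (intro Bochner_Integration.integral_norm_bound_integral integrable_bounded_borel
        bounded_borel_intros f) auto
  then show ?thesis by (simp add: gauss.prob_space[simplified])
qed

lemma norm_char_count_le: "cmod (char_count t n) \<le> 1"
  unfolding char_count_eq by (intro norm_integral_le_const bounded_borel_cis_count) simp

lemma norm_char_count_diff_le: "cmod (char_count t n - char_count t (Suc n)) \<le> \<bar>t\<bar>"
proof -
  have "char_count t n - char_count t (Suc n) = (\<integral>x. cis (t * count n x) - cis (t * count (Suc n) x) \<partial>gauss_measure)"
    unfolding char_count_eq
    by (intro Bochner_Integration.integral_diff[symmetric] integrable_bounded_borel bounded_borel_cis_count)
  also have "cmod \<dots> \<le> \<bar>t\<bar>"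
  proof (intro norm_integral_le_const bounded_borel_diff bounded_borel_cis_count)
    fix x
    have "cis (t * count n x) - cis (t * count (Suc n) x) = - (cis (t * count n x) * ((cis t - 1)
        * complex_of_real (indicator (large_digit (b (Suc n))) ((gauss_map ^^ n) x))))"
      unfolding cis_count_Suc by (simp add: algebra_simps)
    then show "cmod (cis (t * count n x) - cis (t * count (Suc n) x)) \<le> \<bar>t\<bar>"
      using norm_cis_minus_one_le[of t] by (simp add: norm_mult indicator_def)
  qed
  finally show ?thesis .
qed

lemma integral_char_rem: "(\<integral>x. char_rem t n x \<partial>gauss_measure) = 0"
proof -
  note intros = integrable_bounded_borel bounded_borel_intros
  have "(\<integral>x. char_rem t n x \<partial>gauss_measure)
      = (\<integral>x. char_density t n x - (char_count t n
          + char_count t n * (cis t - 1) * complex_of_real (cond_centred n x)) \<partial>gauss_measure)"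
    by (intro Bochner_Integration.integral_cong refl) (simp add: char_rem_def algebra_simps)
  also have "\<dots> = char_count t n - (char_count t n
      + char_count t n * (cis t - 1) * complex_of_real (\<integral>x. cond_centred n x \<partial>gauss_measure))"
    by (simp add: intros char_count_def gauss.prob_space[simplified] del: integral_cond_centred)
  finally show ?thesis by simp
qed

lemma norm_cond_centred_le:
  "x \<in> {0..1} \<Longrightarrow> norm (complex_of_real (cond_centred n x)) \<le> 3 / 2"
  using abs_cond_centred_le by simp

text \<open>Up to an additive constant, the remainder is transferred with a perturbation by terms of
  second order in \<^term>\<open>t\<close>: the definition of \<^const>\<open>cond_centred\<close> makes the terms of first
  order cancel.\<close>

lemma char_rem_Suc:
  fixes t x :: real and n :: nat
  assumes x: "x \<in> {0..1}"
  defines "\<zeta> \<equiv> cis t - 1" and "c \<equiv> char_count t n" and "c' \<equiv> char_count t (Suc n)"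
  shows "char_rem t (Suc n) x = gauss_transfer (char_rem t n) x
    + \<zeta> * gauss_tail_transfer (b (Suc n)) (char_rem t n) x
    + \<zeta>\<^sup>2 * c * gauss_tail_transfer (b (Suc n)) (\<lambda>y. complex_of_real (cond_centred n y)) x
    + (c - c') * \<zeta> * complex_of_real (cond_centred (Suc n) x)
    + (c + c * \<zeta> * prb (Suc n) - c')"
proof -
  let ?P = "gauss_transfer :: (real \<Rightarrow> complex) \<Rightarrow> _" and ?Q = "gauss_tail_transfer (b (Suc n)) :: (real \<Rightarrow> complex) \<Rightarrow> _"
  let ?e = "\<lambda>y. complex_of_real (cond_centred n y)"
  have density: "char_density t n = (\<lambda>y. char_rem t n y + (c + (c * \<zeta>) * ?e y))"
    by (rule ext) (simp add: char_rem_def c_def \<zeta>_def algebra_simps)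
  obtain B where R: "\<And>y. y \<in> {0..1} \<Longrightarrow> norm (char_rem t n y) \<le> B"
    using bounded_borelE[OF bounded_borel_char_rem] by metis
  have ce: "\<And>y. y \<in> {0..1} \<Longrightarrow> norm (c * \<zeta> * ?e y) \<le> norm (c * \<zeta>) * (3 / 2)"
    unfolding norm_mult[of "c * \<zeta>"] by (intro mult_left_mono norm_cond_centred_le) auto
  have cc: "\<And>y::real. y \<in> {0..1} \<Longrightarrow> norm c \<le> norm c" by simp
  have sum: "\<And>y. y \<in> {0..1} \<Longrightarrow> norm (c + c * \<zeta> * ?e y) \<le> norm c + norm (c * \<zeta>) * (3 / 2)"
    by (intro order_trans[OF norm_triangle_ineq] add_mono ce) auto
  have P: "?P (char_density t n) x = ?P (char_rem t n) x + (c + (c * \<zeta>) * of_real (gauss_transfer (cond_centred n) x))"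
  proof -
    have "?P (char_density t n) x = ?P (char_rem t n) x + ?P (\<lambda>y. c + c * \<zeta> * ?e y) x"
      unfolding density by (rule gauss_transfer_add[OF R sum x])
    also have "?P (\<lambda>y. c + c * \<zeta> * ?e y) x = c + ?P (\<lambda>y. c * \<zeta> * ?e y) x"
      using gauss_transfer_add[of "\<lambda>_. c" "norm c" "\<lambda>y. c * \<zeta> * ?e y", OF cc ce x] x by simp
    also have "?P (\<lambda>y. c * \<zeta> * ?e y) x = c * \<zeta> * of_real (gauss_transfer (cond_centred n) x)"
      using gauss_transfer_linear[of "\<lambda>z. c * \<zeta> * complex_of_real z" "cond_centred n" "3 / 2" x]
        abs_cond_centred_le x
      by (simp add: bounded_linear_const_mult[OF bounded_linear_of_real])
    finally show ?thesis .
  qed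
  have Q: "?Q (char_density t n) x = ?Q (char_rem t n) x
      + (c * of_real (gauss_tail_transfer (b (Suc n)) (\<lambda>_. 1) x) + c * \<zeta> * ?Q ?e x)"
  proof -
    have "?Q (char_density t n) x = ?Q (char_rem t n) x + ?Q (\<lambda>y. c + c * \<zeta> * ?e y) x"
      unfolding density by (rule gauss_tail_transfer_add[OF R sum x])
    also have "?Q (\<lambda>y. c + c * \<zeta> * ?e y) x = ?Q (\<lambda>y. c) x + ?Q (\<lambda>y. c * \<zeta> * ?e y) x"
      by (rule gauss_tail_transfer_add[of "\<lambda>_. c" "norm c" "\<lambda>y. c * \<zeta> * ?e y", OF cc ce x])
    also have "?Q (\<lambda>y. c * \<zeta> * ?e y) x = c * \<zeta> * ?Q ?e x"
      using gauss_tail_transfer_linear[of "\<lambda>z. c * \<zeta> * z" ?e "3 / 2" x]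
        norm_cond_centred_le x
      by (simp add: bounded_linear_mult_right)
    also have "?Q (\<lambda>y. c) x = c * of_real (gauss_tail_transfer (b (Suc n)) (\<lambda>_. 1) x)"
      using x by (simp add: gauss_tail_transfer_const scaleR_conv_of_real)
    finally show ?thesis .
  qed
  show ?thesis
    unfolding char_rem_def[of t "Suc n"] c'_def[symmetric] char_density.simps \<zeta>_def[symmetric] P Q
    by (simp add: algebra_simps power2_eq_square)
qed

text \<open>The contraction absorbs the perturbation: the bound \<open>54 * t\<^sup>2\<close> is large enough to
  reproduce itself under the recursion. Since the remainder has mean zero, the same bound holds for
  its supremum.\<close>

lemma lipschitz_char_rem:
  assumes t: "\<bar>t\<bar> \<le> 1 / 24"
  shows "(54 * t\<^sup>2)-lipschitz_on {0..1} (char_rem t n)"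
proof (induction n)
  case 0
  have "char_rem t 0 = (\<lambda>_. 0)"
    by (rule ext) (simp add: char_rem_def char_count_def gauss.prob_space[simplified])
  then show ?case by (simp add: lipschitz_on_def)
next
  case (Suc n)
  define \<zeta> where "\<zeta> = cis t - 1"
  define c where "c = char_count t n"
  define c' where "c' = char_count t (Suc n)"
  define L where "L = 54 * t\<^sup>2"
  have \<zeta>: "cmod \<zeta> \<le> \<bar>t\<bar>" unfolding \<zeta>_def by (rule norm_cis_minus_one_le)
  have b: "b (Suc n) \<ge> 1" using b_pos[of "Suc n"] by simp
  have IH: "L-lipschitz_on {0..1} (char_rem t n)" using Suc by (simp add: L_def)
  have R: "norm (char_rem t n y) \<le> L" if "y \<in> {0..1}" for y
    by (rule norm_le_lipschitz_mean_zero[OF IH bounded_borel_char_rem integral_char_rem that])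
  have e: "(3 / 2)-lipschitz_on {0..1} (\<lambda>y. complex_of_real (cond_centred n y))" for n
    by (intro lipschitz_on_of_real lipschitz_cond_centred)
  have "(5 / 6 * L + cmod \<zeta> * (L + L) + cmod (\<zeta>\<^sup>2 * c) * (3 / 2 + 3 / 2) + cmod ((c - c') * \<zeta>) * (3 / 2) + 0)-lipschitz_on {0..1}
      (\<lambda>x. gauss_transfer (char_rem t n) x
        + \<zeta> * gauss_tail_transfer (b (Suc n)) (char_rem t n) x
        + \<zeta>\<^sup>2 * c * gauss_tail_transfer (b (Suc n)) (\<lambda>y. complex_of_real (cond_centred n y)) x
        + (c - c') * \<zeta> * complex_of_real (cond_centred (Suc n) x)
        + (c + c * \<zeta> * prb (Suc n) - c'))"
    by (intro lipschitz_on_add lipschitz_on_mult_left lipschitz_gauss_transfer lipschitz_gauss_tail_transfer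
        lipschitz_on_constant IH e R norm_cond_centred_le b)
  then have "(5 / 6 * L + cmod \<zeta> * (L + L) + cmod (\<zeta>\<^sup>2 * c) * (3 / 2 + 3 / 2) + cmod ((c - c') * \<zeta>) * (3 / 2) + 0)-lipschitz_on {0..1}
      (char_rem t (Suc n))"
    by (rule lipschitz_on_transform) (simp add: char_rem_Suc \<zeta>_def c_def c'_def del: cond_centred.simps)
  moreover have "5 / 6 * L + cmod \<zeta> * (L + L) + cmod (\<zeta>\<^sup>2 * c) * (3 / 2 + 3 / 2) + cmod ((c - c') * \<zeta>) * (3 / 2) + 0 \<le> L"
  proof -
    have L0: "0 \<le> L" by (simp add: L_def)
    have "cmod \<zeta> * (L + L) \<le> 1 / 24 * (L + L)"
      using \<zeta> t L0 by (intro mult_right_mono) auto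
    then have 1: "5 / 6 * L + cmod \<zeta> * (L + L) \<le> 11 / 12 * L" by simp
    have 2: "cmod (\<zeta>\<^sup>2 * c) \<le> \<bar>t\<bar>\<^sup>2 * 1"
      unfolding norm_mult norm_power c_def
      by (intro mult_mono power_mono \<zeta> norm_char_count_le) auto
    have 3: "cmod ((c - c') * \<zeta>) \<le> \<bar>t\<bar> * \<bar>t\<bar>"
      unfolding norm_mult c_def c'_def
      by (intro mult_mono \<zeta> norm_char_count_diff_le) auto
    have "u + v * (3 / 2 + 3 / 2) + w * (3 / 2) + 0 \<le> L"
      if "u \<le> 11 / 12 * L" "v \<le> t\<^sup>2" "w \<le> t\<^sup>2" for u v w
      using that unfolding L_def by simp
    from this[OF 1] 2 3 show ?thesis by (simp add: power2_eq_square)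
  qed
  ultimately show ?case
    unfolding L_def[symmetric] by (rule lipschitz_on_mono[OF _ order_refl])
qed

lemma char_count_Suc:
  assumes t: "\<bar>t\<bar> \<le> 1 / 24"
  shows "cmod (char_count t (Suc n) - char_count t n * (1 + (cis t - 1) * prb (Suc n) + (cis t - 1)\<^sup>2 * corr (Suc n)))
    \<le> 54 * \<bar>t\<bar> ^ 3 * prb (Suc n)"
proof -
  let ?A = "large_digit (b (Suc n))" and ?c = "char_count t n" and ?\<zeta> = "cis t - 1"
  note intros = integrable_bounded_borel bounded_borel_intros
  have "char_count t (Suc n) = (\<integral>x. gauss_transfer (char_density t n) x \<partial>gauss_measure)
      + ?\<zeta> * (\<integral>x. gauss_tail_transfer (b (Suc n)) (char_density t n) x \<partial>gauss_measure)"
    unfolding char_count_def by (simp add: intros)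
  also have "(\<integral>x. gauss_transfer (char_density t n) x \<partial>gauss_measure) = ?c"
    unfolding char_count_def by (intro integral_gauss_transfer bounded_borel_intros)
  also have "(\<integral>x. gauss_tail_transfer (b (Suc n)) (char_density t n) x \<partial>gauss_measure)
      = (\<integral>x. indicator ?A x *\<^sub>R char_density t n x \<partial>gauss_measure)"
    using integral_large_digit_mult_gauss_map[OF bounded_borel_char_density bounded_borel_const[of 1], of "b (Suc n)" t n]
    by simp
  also have "\<dots> = (\<integral>x. ?c * complex_of_real (indicator ?A x)
      + (?c * ?\<zeta> * complex_of_real (indicator ?A x * cond_centred n x) + indicator ?A x *\<^sub>R char_rem t n x) \<partial>gauss_measure)"
    by (intro Bochner_Integration.integral_cong refl)
       (simp add: char_rem_def scaleR_conv_of_real algebra_simps)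
  also have "\<dots> = ?c * prb (Suc n) + (?c * ?\<zeta> * corr (Suc n) + (\<integral>x. indicator ?A x *\<^sub>R char_rem t n x \<partial>gauss_measure))"
  proof -
    have "(\<integral>x. ?c * complex_of_real (indicator ?A x) \<partial>gauss_measure) = ?c * prb (Suc n)"
      unfolding prb_def by (simp only: integral_mult_right_zero integral_complex_of_real)
    moreover have "(\<integral>x. ?c * ?\<zeta> * complex_of_real (indicator ?A x * cond_centred n x) \<partial>gauss_measure)
        = ?c * ?\<zeta> * corr (Suc n)"
      unfolding corr_def by (simp only: integral_mult_right_zero integral_complex_of_real diff_Suc_1)
    ultimately show ?thesis
      by (subst Bochner_Integration.integral_add, (intro intros)+)+ simp
  qed
  finally have "char_count t (Suc n) - ?c * (1 + ?\<zeta> * prb (Suc n) + ?\<zeta>\<^sup>2 * corr (Suc n))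
      = ?\<zeta> * (\<integral>x. indicator ?A x *\<^sub>R char_rem t n x \<partial>gauss_measure)"
    by (simp add: algebra_simps power2_eq_square)
  also have "cmod \<dots> \<le> \<bar>t\<bar> * (54 * t\<^sup>2 * prb (Suc n))"
    unfolding norm_mult
  proof (intro mult_mono norm_cis_minus_one_le)
    have R: "norm (char_rem t n y) \<le> 54 * t\<^sup>2" if "y \<in> {0..1}" for y
      by (rule norm_le_lipschitz_mean_zero[OF lipschitz_char_rem[OF t] bounded_borel_char_rem integral_char_rem that])
    have "cmod (\<integral>x. indicator ?A x *\<^sub>R char_rem t n x \<partial>gauss_measure)
        \<le> (\<integral>x. 54 * t\<^sup>2 * indicator ?A x \<partial>gauss_measure)"
      using R by (intro Bochner_Integration.integral_norm_bound_integral intros) (auto simp: indicator_def)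
    then show "cmod (\<integral>x. indicator ?A x *\<^sub>R char_rem t n x \<partial>gauss_measure) \<le> 54 * t\<^sup>2 * prb (Suc n)"
      by simp
  qed auto
  finally show ?thesis by (simp add: power2_eq_square power3_eq_cube mult_ac)
qed

text \<open>The characteristic function of the centred count is Gaussian up to a relative error
  controlled by the mean of the count.\<close>

lemma char_count_asymp:
  assumes t: "\<bar>t\<bar> \<le> 1 / 24"
  defines "m \<equiv> \<lambda>n. \<Sum>k<n. prb (Suc k)" and "V \<equiv> \<lambda>n. \<Sum>k<n. var_incr (Suc k)"
  shows "cmod (char_count t n * exp (complex_of_real (t\<^sup>2 * V n / 2) - \<i> * t * m n) - 1)
    \<le> 104 * \<bar>t\<bar> ^ 3 * m n * exp (2 * t\<^sup>2 * m n)"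
proof (induction n)
  case 0
  show ?case by (simp add: char_count_def m_def V_def gauss.prob_space[simplified])
next
  case (Suc n)
  define p where "p = prb (Suc n)"
  define e where "e = corr (Suc n)"
  define v where "v = var_incr (Suc n)"
  define X where "X n = exp (complex_of_real (t\<^sup>2 * V n / 2) - \<i> * t * m n)" for n
  define w where "w = \<i> * t * p - complex_of_real (t\<^sup>2 * v / 2)"
  let ?c = "char_count t n" and ?c' = "char_count t (Suc n)" and ?\<zeta> = "cis t - 1"
  define E where "E = exp (2 * t\<^sup>2 * m (Suc n))"
  have p0: "0 \<le> p" "p \<le> 1" unfolding p_def by (simp_all add: prb_nonneg prb_le_1)
  have m_nonneg: "0 \<le> m k" for k unfolding m_def by (intro sum_nonneg) (simp add: prb_nonneg)
  have m_Suc: "m (Suc n) = m n + p" and V_Suc: "V (Suc n) = V n + v"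
    by (simp_all add: m_def V_def p_def v_def)
  have X_eq: "X n = X (Suc n) * exp w"
    unfolding X_def w_def m_Suc V_Suc by (simp add: exp_add[symmetric] algebra_simps add_divide_distrib)
  have V_le: "V k \<le> 4 * m k" for k
    unfolding V_def m_def sum_distrib_left
    using abs_var_incr_le by (intro sum_mono) (simp add: abs_le_iff)
  have X_norm: "cmod (X (Suc n)) \<le> E"
  proof -
    have "cmod (X (Suc n)) = exp (t\<^sup>2 * V (Suc n) / 2)" by (simp add: X_def)
    also have "\<dots> \<le> exp (t\<^sup>2 * (4 * m (Suc n)) / 2)"
      unfolding exp_le_cancel_iff by (intro divide_right_mono mult_left_mono V_le) auto
    finally show ?thesis by (simp add: E_def mult_ac)
  qed
  have step: "cmod (1 + ?\<zeta> * p + ?\<zeta>\<^sup>2 * e - exp w) \<le> 50 * \<bar>t\<bar> ^ 3 * p"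
    unfolding w_def v_def var_incr_def p_def e_def
    by (rule exp_quadratic_step[OF prb_nonneg prb_le_1 abs_corr_le t])
  have "?c' * X (Suc n) - ?c * X n = X (Suc n) * ((?c' - ?c * (1 + ?\<zeta> * p + ?\<zeta>\<^sup>2 * e)) + ?c * (1 + ?\<zeta> * p + ?\<zeta>\<^sup>2 * e - exp w))"
    unfolding X_eq by (simp add: algebra_simps)
  also have "cmod \<dots> \<le> E * (54 * \<bar>t\<bar> ^ 3 * p + 1 * (50 * \<bar>t\<bar> ^ 3 * p))"
    unfolding norm_mult
  proof (intro mult_mono X_norm order_trans[OF norm_triangle_ineq] add_mono)
    show "cmod (?c' - ?c * (1 + ?\<zeta> * p + ?\<zeta>\<^sup>2 * e)) \<le> 54 * \<bar>t\<bar> ^ 3 * p"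
      unfolding p_def e_def by (rule char_count_Suc[OF t])
    show "cmod (?c * (1 + ?\<zeta> * p + ?\<zeta>\<^sup>2 * e - exp w)) \<le> 1 * (50 * \<bar>t\<bar> ^ 3 * p)"
      unfolding norm_mult by (intro mult_mono norm_char_count_le step) auto
  qed (auto simp: E_def)
  finally have diff: "cmod (?c' * X (Suc n) - ?c * X n) \<le> 104 * \<bar>t\<bar> ^ 3 * p * E"
    by (simp add: algebra_simps)
  have "cmod (?c * X n - 1) \<le> 104 * \<bar>t\<bar> ^ 3 * m n * exp (2 * t\<^sup>2 * m n)"
    unfolding X_def by (rule Suc)
  also have "\<dots> \<le> 104 * \<bar>t\<bar> ^ 3 * m n * E"
    unfolding E_def m_Suc using p0 m_nonneg
    by (intro mult_left_mono) (auto intro!: mult_left_mono mult_nonneg_nonneg)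
  finally have "cmod (?c' * X (Suc n) - 1) \<le> 104 * \<bar>t\<bar> ^ 3 * p * E + 104 * \<bar>t\<bar> ^ 3 * m n * E"
    using norm_triangle_le[OF add_mono[OF diff], of "?c * X n - 1"] by simp
  then show ?case
    unfolding X_def E_def m_Suc by (simp add: algebra_simps)
qed

end

section \<open>The central limit theorem\<close>

lemma measure_std_normal_lessThan:
  "measure std_normal_distribution {..<z} = 1 / sqrt (2 * pi) * (LBINT t:{..z}. exp (- t\<^sup>2 / 2))"
proof -
  interpret N: real_distribution std_normal_distribution by (rule real_dist_normal_dist)
  have "measure std_normal_distribution {..<z} = (\<integral>x. indicator {..<z} x \<partial>std_normal_distribution)"
    by simp
  also have "\<dots> = (\<integral>x. std_normal_density x * indicator {..<z} x \<partial>lborel)"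
    by (subst integral_density) auto
  also have "\<dots> = (\<integral>x. 1 / sqrt (2 * pi) * (indicator {..z} x * exp (- x\<^sup>2 / 2)) \<partial>lborel)"
  proof (intro integral_cong_AE)
    have "AE x in lborel. x \<noteq> z" by (rule AE_lborel_singleton)
    then show "AE x in lborel. std_normal_density x * indicator {..<z} x
        = 1 / sqrt (2 * pi) * (indicator {..z} x * exp (- x\<^sup>2 / 2))"
      by eventually_elim (auto simp: indicator_def std_normal_density_def)
  qed auto
  also have "\<dots> = 1 / sqrt (2 * pi) * (\<integral>x. indicator {..z} x * exp (- x\<^sup>2 / 2) \<partial>lborel)"
    by (rule Bochner_Integration.integral_mult_right_zero)
  finally show ?thesis by (simp add: set_lebesgue_integral_def)
qed

lemma emeasure_std_normal_singleton: "emeasure std_normal_distribution {z} = 0"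
  by (subst emeasure_density) (auto intro!: nn_integral_null_set simp: null_sets_def)

context digit_thresholds
begin

text \<open>The mean and the variance of the count.\<close>

definition mean :: "nat \<Rightarrow> real" where
  "mean n = (\<Sum>k<n. prb (Suc k))"

definition var :: "nat \<Rightarrow> real" where
  "var n = (\<Sum>k<n. var_incr (Suc k))"

definition normalized :: "nat \<Rightarrow> real \<Rightarrow> real" where
  "normalized n x = (count n x - mean n) / sqrt (var n)"

lemma measurable_normalized [measurable]: "normalized n \<in> borel_measurable gauss_measure"
proof -
  have [measurable]: "count n \<in> borel_measurable gauss_measure"
    using bounded_borel_count by (intro borel_measurable_gauss_measure bounded_borel_measurable)
  show ?thesis unfolding normalized_def by measurable
qed

lemma mean_le_var: "mean n \<le> 9408 * var n"
proof -
  have "mean n \<le> 2 * (\<Sum>k<n. 1 / real (b (Suc k)))"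
    unfolding mean_def sum_distrib_left by (intro sum_mono prb_le) simp
  then show ?thesis using variance_lower_bound[of n] unfolding var_def by linarith
qed

lemma char_normalized:
  "char (distr gauss_measure borel (normalized n)) s
    = char_count (s / sqrt (var n)) n * exp (- (\<i> * (s / sqrt (var n)) * mean n))"
proof -
  let ?t = "s / sqrt (var n)"
  have "char (distr gauss_measure borel (normalized n)) s = (\<integral>x. exp (\<i> * of_real (s * normalized n x)) \<partial>gauss_measure)"
    unfolding char_def by (subst integral_distr) auto
  also have "\<dots> = (\<integral>x. cis (?t * count n x) * exp (- (\<i> * ?t * mean n)) \<partial>gauss_measure)"
  proof (intro Bochner_Integration.integral_cong refl)
    fix x
    have "s * normalized n x = ?t * count n x - ?t * mean n"
      by (simp add: normalized_def algebra_simps diff_divide_distrib)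
    then show "exp (\<i> * of_real (s * normalized n x)) = cis (?t * count n x) * exp (- (\<i> * ?t * mean n))"
      by (simp only: cis_conv_exp exp_add[symmetric]) (simp add: algebra_simps)
  qed
  also have "\<dots> = char_count ?t n * exp (- (\<i> * ?t * mean n))"
    unfolding char_count_eq by (rule Bochner_Integration.integral_mult_left_zero)
  finally show ?thesis .
qed

text \<open>The error of \<open>char_count_asymp\<close> at \<^term>\<open>s / sqrt (var n)\<close> vanishes in the limit because
  the mean is at most a multiple of the variance.\<close>

lemma norm_char_normalized_diff_le:
  assumes pos: "0 < var n" and small: "\<bar>s\<bar> \<le> 1 / 24 * sqrt (var n)"
  shows "cmod (char (distr gauss_measure borel (normalized n)) s - exp (complex_of_real (- s\<^sup>2 / 2)))
    \<le> 104 * 9408 * \<bar>s\<bar> ^ 3 * exp (18816 * s\<^sup>2) * (1 / sqrt (var n))"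
proof -
  define t where "t = s / sqrt (var n)"
  have t_small: "\<bar>t\<bar> \<le> 1 / 24" using small pos by (simp add: t_def field_simps)
  have t2: "t\<^sup>2 * var n = s\<^sup>2" using pos by (simp add: t_def power_divide)
  have "t\<^sup>2 * mean n \<le> t\<^sup>2 * (9408 * var n)" by (intro mult_left_mono mean_le_var) auto
  then have t2_mean: "t\<^sup>2 * mean n \<le> 9408 * s\<^sup>2" using t2 by simp
  define a where "a = char_count t n * exp (complex_of_real (t\<^sup>2 * var n / 2) - \<i> * t * mean n)"
  have "char (distr gauss_measure borel (normalized n)) s = exp (complex_of_real (- s\<^sup>2 / 2)) * a"
    unfolding char_normalized t_def[symmetric] a_def t2
    by (simp add: exp_add[symmetric] exp_diff exp_minus field_simps)
  then have "char (distr gauss_measure borel (normalized n)) s - exp (complex_of_real (- s\<^sup>2 / 2))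
      = exp (complex_of_real (- s\<^sup>2 / 2)) * (a - 1)"
    by (simp add: algebra_simps)
  then have "cmod (char (distr gauss_measure borel (normalized n)) s - exp (complex_of_real (- s\<^sup>2 / 2)))
      = exp (- s\<^sup>2 / 2) * cmod (a - 1)"
    by (simp add: norm_mult)
  also have "\<dots> \<le> 1 * (104 * \<bar>t\<bar> ^ 3 * mean n * exp (2 * t\<^sup>2 * mean n))"
    using char_count_asymp[OF t_small, of n]
    by (intro mult_mono) (auto simp: a_def mean_def var_def)
  also have "104 * \<bar>t\<bar> ^ 3 * mean n = 104 * \<bar>t\<bar> * (t\<^sup>2 * mean n)"
    by (simp add: power3_eq_cube power2_eq_square abs_mult_self_eq)
  also have "1 * (104 * \<bar>t\<bar> * (t\<^sup>2 * mean n) * exp (2 * t\<^sup>2 * mean n))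
      \<le> 104 * \<bar>t\<bar> * (9408 * s\<^sup>2) * exp (18816 * s\<^sup>2)"
    unfolding mult_1_left
  proof (rule mult_mono)
    show "104 * \<bar>t\<bar> * (t\<^sup>2 * mean n) \<le> 104 * \<bar>t\<bar> * (9408 * s\<^sup>2)"
      by (rule mult_left_mono[OF t2_mean]) simp
    show "exp (2 * t\<^sup>2 * mean n) \<le> exp (18816 * s\<^sup>2)" using t2_mean by (simp add: mult_ac)
  qed auto
  also have "\<dots> = 104 * 9408 * \<bar>s\<bar> ^ 3 * exp (18816 * s\<^sup>2) * (1 / sqrt (var n))"
    using pos by (simp add: t_def abs_divide power3_eq_cube power2_eq_square abs_mult_self_eq)
  finally show ?thesis .
qed

lemma char_normalized_tendsto:
  assumes "filterlim var at_top sequentially"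
  shows "(\<lambda>n. char (distr gauss_measure borel (normalized n)) s) \<longlonglongrightarrow> char std_normal_distribution s"
proof -
  define K where "K = 104 * 9408 * \<bar>s\<bar> ^ 3 * exp (18816 * s\<^sup>2)"
  have sqrt_var: "filterlim (\<lambda>n. sqrt (var n)) at_top sequentially"
    using assms by (rule filterlim_compose[OF sqrt_at_top])
  have "eventually (\<lambda>n. 0 < var n) sequentially"
    using assms unfolding filterlim_at_top_dense by blast
  moreover have "eventually (\<lambda>n. 24 * \<bar>s\<bar> \<le> sqrt (var n)) sequentially"
    using sqrt_var unfolding filterlim_at_top by blast
  ultimately have "eventually (\<lambda>n. cmod (char (distr gauss_measure borel (normalized n)) s
      - exp (complex_of_real (- s\<^sup>2 / 2))) \<le> K * (1 / sqrt (var n))) sequentially"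
    unfolding K_def by eventually_elim (rule norm_char_normalized_diff_le, auto)
  moreover have "(\<lambda>n. K * (1 / sqrt (var n))) \<longlonglongrightarrow> 0"
    by (intro tendsto_mult_right_zero real_tendsto_divide_at_top[OF tendsto_const sqrt_var])
  ultimately have "(\<lambda>n. char (distr gauss_measure borel (normalized n)) s
      - exp (complex_of_real (- s\<^sup>2 / 2))) \<longlonglongrightarrow> 0"
    by (rule Lim_null_comparison)
  then show ?thesis
    unfolding char_std_normal_distribution by (subst Lim_null) (simp add: exp_of_real[symmetric])
qed

lemma prob_normalized_tendsto:
  assumes "filterlim var at_top sequentially"
  shows "(\<lambda>n. gauss.prob {x \<in> space gauss_measure. normalized n x < z})
    \<longlonglongrightarrow> 1 / sqrt (2 * pi) * (LBINT t:{..z}. exp (- t\<^sup>2 / 2))"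
proof -
  let ?D = "\<lambda>n. distr gauss_measure borel (normalized n)"
  have D: "real_distribution (?D n)" for n
    by (rule gauss.real_distribution_distr) measurable
  have "weak_conv_m ?D std_normal_distribution"
    by (rule levy_continuity[OF D real_dist_normal_dist char_normalized_tendsto[OF assms]])
  then have "(\<lambda>n. measure (?D n) {..<z}) \<longlonglongrightarrow> measure std_normal_distribution {..<z}"
    using emeasure_std_normal_singleton
    by (intro weak_conv_imp_continuity_set_conv D real_dist_normal_dist) auto
  moreover have "measure (?D n) {..<z} = gauss.prob {x \<in> space gauss_measure. normalized n x < z}" for n
    by (subst measure_distr) (auto simp del: space_gauss_measure intro!: arg_cong[where f = gauss.prob])
  ultimately show ?thesis by (simp only: measure_std_normal_lessThan)
qed

end

theorem theorem1p4:
  fixes b :: "nat \<Rightarrow> nat" and z :: real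
  assumes b_pos: "\<And>n. n \<ge> 1 \<Longrightarrow> b n > 0"
    and b_div: "filterlim (\<lambda>n. \<Sum>k = 1..n. 1 / real (b k)) at_top sequentially"
  shows "(\<lambda>n. gauss.prob {\<omega> \<in> space gauss_measure.
              (exceedance_count b n \<omega> - gauss.expectation (exceedance_count b n))
                / sqrt (gauss.variance (exceedance_count b n)) < z})
         \<longlonglongrightarrow> 1 / sqrt (2 * pi) * (LBINT t:{..z}. exp (- t\<^sup>2 / 2))"
proof -
  interpret digit_thresholds b by unfold_locales (rule b_pos)
  have "filterlim (\<lambda>n. 1 / 4704 * (\<Sum>k = 1..n. 1 / real (b k))) at_top sequentially"
    by (rule filterlim_tendsto_pos_mult_at_top[OF tendsto_const _ b_div]) simp
  then have "filterlim var at_top sequentially"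
    by (rule filterlim_at_top_mono)
       (use variance_lower_bound in \<open>simp add: var_def sum.atLeast1_atMost_eq\<close>)
  moreover have "{\<omega> \<in> space gauss_measure.
        (exceedance_count b n \<omega> - gauss.expectation (exceedance_count b n))
          / sqrt (gauss.variance (exceedance_count b n)) < z}
      = {\<omega> \<in> space gauss_measure. normalized n \<omega> < z}" for n
    unfolding expectation_exceedance_count mean_def[symmetric] normalized_def
    using variance_exceedance_count[of n]
    by (auto simp: exceedance_count_eq var_def mean_def expectation_exceedance_count)
  ultimately show ?thesis
    using prob_normalized_tendsto by simp
qed

end
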